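(* Let $n\ge2$ be a fixed number of online observations of arm $k$, and let $\mathcal F_{k,n}=\sigma\left(\{\hat R^{\mathrm{off}}_{k,s}\}_{s=1}^{N_k},\{\hat R_{k,s}\}_{s=1}^n\right)$ be the $\sigma$-field generated by the surrogate rewards. Then $\hat\mu^{\mathrm{MLA}}_{k,n}$ can be decomposed as $$\hat\mu^{\mathrm{MLA}}_{k,n}=\mu_k+S_{1,k,n}+S_{2,k,n},$$ where $S_{1,k,n}$ and $S_{2,k,n}$ are independent random variables, $S_{1,k,n}$ is $\mathcal F_{k,n}$-measurable, $$S_{1,k,n}\sim\mathcal N\left(0,\frac1{n+N_k}\rho_k^2\sigma_k^2\right),\qquad S_{2,k,n}\mid\mathcal F_{k,n}\sim\mathcal N\left(0,\frac1nZ_{k,n}(1-\rho_k^2)\sigma_k^2\right),$$ and $Z_{k,n}$ is the $\mathcal F_{k,n}$-measurable random variable $$Z_{k,n}=1+\frac{n\left(\mathbb{E}_{k,n}[\hat R]-\mathbb{E}^{\mathrm{all}}_{k,n}[\hat R]\right)^2}{\sum_{s=1}^n\left(\hat R_{k,s}-\mathbb{E}_{k,n}[\hat R]\right)^2}.$$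
   Context: Fix an arm $k$ with parameters $\mu_k,\tilde\mu_k\in\mathbb{R}$, $\sigma_k,\tilde\sigma_k>0$, $\rho_k\in(-1,1)$. The online pairs $(R_{k,s},\hat R_{k,s})$ (true reward, surrogate reward), $s=1,2,\dots$, are i.i.d. bivariate normal with mean $(\mu_k,\tilde\mu_k)$ and covariance matrix $\begin{pmatrix}\sigma_k^2&\rho_k\sigma_k\tilde\sigma_k\\ \rho_k\sigma_k\tilde\sigma_k&\tilde\sigma_k^2\end{pmatrix}$. The offline surrogate rewards $\hat R^{\mathrm{off}}_{k,1},\dots,\hat R^{\mathrm{off}}_{k,N_k}$ ($N_k\ge1$) are i.i.d. $\mathcal N(\tilde\mu_k,\tilde\sigma_k^2)$, independent of the online pairs. Notation: $\mathbb{E}_{k,n}[R]=\frac1n\sum_{s=1}^nR_{k,s}$, $\mathbb{E}_{k,n}[\hat R]=\frac1n\sum_{s=1}^n\hat R_{k,s}$, $\mathbb{E}_k^{\mathrm{off}}[\hat R]=\frac1{N_k}\sum_{s=1}^{N_k}\hat R^{\mathrm{off}}_{k,s}$, $\mathbb{E}^{\mathrm{all}}_{k,n}[\hat R]=\frac1{n+N_k}\big(\sum_{s=1}^n\hat R_{k,s}+\sum_{s=1}^{N_k}\hat R^{\mathrm{off}}_{k,s}\big)$, $\hat\sigma_{R,\hat R,k,n}=\frac1{n-1}\sum_{s=1}^n(R_{k,s}-\mathbb{E}_{k,n}[R])(\hat R_{k,s}-\mathbb{E}_{k,n}[\hat R])$, $\hat\sigma^2_{\hat R,k,n}=\frac1{n-1}\sum_{s=1}^n(\hat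 R_{k,s}-\mathbb{E}_{k,n}[\hat R])^2$. The machine learning-assisted mean estimator is $$\hat\mu^{\mathrm{MLA}}_{k,n}=\mathbb{E}_{k,n}[R]-\hat\lambda_{k,n}\left(\mathbb{E}_{k,n}[\hat R]-\mathbb{E}_k^{\mathrm{off}}[\hat R]\right),\qquad\hat\lambda_{k,n}=\frac{N_k}{n+N_k}\frac{\hat\sigma_{R,\hat R,k,n}}{\hat\sigma^2_{\hat R,k,n}}.$$ *)

theory Defs
  imports "HOL-Probability.Probability"
begin

definition bivariate_normal_density ::
  "real \<Rightarrow> real \<Rightarrow> real \<Rightarrow> real \<Rightarrow> real \<Rightarrow> real \<times> real \<Rightarrow> real" where
  "bivariate_normal_density \<mu>\<^sub>1 \<mu>\<^sub>2 \<sigma>\<^sub>1 \<sigma>\<^sub>2 \<rho> = (\<lambda>(x, y).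
     1 / (2 * pi * \<sigma>\<^sub>1 * \<sigma>\<^sub>2 * sqrt (1 - \<rho>\<^sup>2)) *
     exp (- (((x - \<mu>\<^sub>1) / \<sigma>\<^sub>1)\<^sup>2 - 2 * \<rho> * ((x - \<mu>\<^sub>1) / \<sigma>\<^sub>1) * ((y - \<mu>\<^sub>2) / \<sigma>\<^sub>2)
             + ((y - \<mu>\<^sub>2) / \<sigma>\<^sub>2)\<^sup>2) / (2 * (1 - \<rho>\<^sup>2))))"

(* Second parameter: the variance v \<ge> 0, not the standard deviation.  Variance 0 is the point
   mass at the mean; normal_density alone does not cover this case. *)
definition normal_law :: "real \<Rightarrow> real \<Rightarrow> real measure" where
  "normal_law m v =
     (if v = 0 then return borel m
      else density lborel (\<lambda>x. ennreal (normal_density m (sqrt v) x)))"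

(* The probability kernel K is a regular conditional distribution of X given F. *)
definition has_cond_distr ::
  "'a measure \<Rightarrow> 'a measure \<Rightarrow> 'b measure \<Rightarrow> ('a \<Rightarrow> 'b) \<Rightarrow> ('a \<Rightarrow> 'b measure) \<Rightarrow> bool" where
  "has_cond_distr M F N X K \<longleftrightarrow>
     subalgebra M F \<and> X \<in> measurable M N \<and> K \<in> measurable F (prob_algebra N) \<and>
     (\<forall>A\<in>sets N. AE \<omega> in M.
        real_cond_exp M F (\<lambda>\<omega>. indicator A (X \<omega>)) \<omega> = measure (K \<omega>) A)"

(* Samples are real sequences indexed from 1.  Below, r and h are the online true and surrogate
   rewards, u the offline surrogate rewards.  Quotients with vanishing denominator, which occur
   with probability 0, are 0 by the convention x / 0 = 0. *)

definition sample_mean :: "nat \<Rightarrow> (nat \<Rightarrow> real) \<Rightarrow> real" where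
  "sample_mean n x = (\<Sum>s=1..n. x s) / real n"

definition pooled_mean :: "nat \<Rightarrow> nat \<Rightarrow> (nat \<Rightarrow> real) \<Rightarrow> (nat \<Rightarrow> real) \<Rightarrow> real" where
  "pooled_mean n N h u = ((\<Sum>s=1..n. h s) + (\<Sum>s=1..N. u s)) / real (n + N)"

definition sample_cov :: "nat \<Rightarrow> (nat \<Rightarrow> real) \<Rightarrow> (nat \<Rightarrow> real) \<Rightarrow> real" where
  "sample_cov n x y =
     (\<Sum>s=1..n. (x s - sample_mean n x) * (y s - sample_mean n y)) / (real n - 1)"

definition sample_var :: "nat \<Rightarrow> (nat \<Rightarrow> real) \<Rightarrow> real" where
  "sample_var n x = (\<Sum>s=1..n. (x s - sample_mean n x)\<^sup>2) / (real n - 1)"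

definition mla_lambda :: "nat \<Rightarrow> nat \<Rightarrow> (nat \<Rightarrow> real) \<Rightarrow> (nat \<Rightarrow> real) \<Rightarrow> real" where
  "mla_lambda n N r h = real N / real (n + N) * (sample_cov n r h / sample_var n h)"

definition mla_mean ::
  "nat \<Rightarrow> nat \<Rightarrow> (nat \<Rightarrow> real) \<Rightarrow> (nat \<Rightarrow> real) \<Rightarrow> (nat \<Rightarrow> real) \<Rightarrow> real" where
  "mla_mean n N r h u =
     sample_mean n r - mla_lambda n N r h * (sample_mean n h - sample_mean N u)"

definition mla_Z :: "nat \<Rightarrow> nat \<Rightarrow> (nat \<Rightarrow> real) \<Rightarrow> (nat \<Rightarrow> real) \<Rightarrow> real" where
  "mla_Z n N h u =
     1 + real n * (sample_mean n h - pooled_mean n N h u)\<^sup>2 /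
         (\<Sum>s=1..n. (h s - sample_mean n h)\<^sup>2)"

definition surrogate_field ::
  "'a measure \<Rightarrow> nat \<Rightarrow> nat \<Rightarrow> (nat \<Rightarrow> 'a \<Rightarrow> real) \<Rightarrow> (nat \<Rightarrow> 'a \<Rightarrow> real) \<Rightarrow> 'a measure" where
  "surrogate_field M n N H U =
     sigma (space M)
       ({U s -` A \<inter> space M | s A. s \<in> {1..N} \<and> A \<in> sets borel} \<union>
        {H s -` A \<inter> space M | s A. s \<in> {1..n} \<and> A \<in> sets borel})"

end

theory Submission
  imports Defs
begin

text \<open>
  Write \<open>\<beta> = \<rho> \<sigma> / \<sigma>'\<close>. The regression residual \<open>E s = R s - (\<mu> + \<beta> (H s - \<mu>'))\<close> is centred
  normal with variance \<open>(1 - \<rho>\<^sup>2) \<sigma>\<^sup>2\<close> and independent of \<open>H s\<close>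
  (\<open>bivariate_normal_regression\<close>). Hence the \<open>n\<close> residuals \<open>E\<close> and the \<open>m = n + N\<close> surrogate
  rewards \<open>X\<close>, online and offline, together form one independent family
  (\<open>indep_vars_regression_family\<close>).

  Substituting \<open>R = \<mu> + \<beta> (H - \<mu>') + E\<close> into the estimator is pure algebra
  (\<open>mla_mean_decomposition\<close>). The sample covariance of \<open>R\<close> and \<open>H\<close> splits into \<open>\<beta>\<close> times the
  sample variance of \<open>H\<close> plus a term linear in \<open>E\<close>, and the first of these cancels all the
  variation of the online mean of \<open>H\<close> around the pooled mean. What remains is
  \<open>S1 = \<beta> (pooled mean - \<mu>')\<close> and a linear combination \<open>S2\<close> of the residuals \<open>E\<close>. Its weights
  are functions of the surrogates whose squares add up to \<open>Z / n\<close>.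

  The law of \<open>S1\<close> is that of a mean of \<open>m\<close> independent normal variables. Given the surrogates the
  weights are constants, so \<open>S2\<close> is a fixed linear combination of independent normal variables;
  \<open>has_cond_distr_freezing\<close> turns this into the conditional law. The weights do not change when
  all surrogates are shifted by the same amount, so \<open>S2\<close> is a function of \<open>E\<close> and of the
  deviations of the surrogates from their mean, whereas \<open>S1\<close> is a function of that mean.
  The mean of a normal sample is independent of the deviations from it
  (\<open>sample_mean_indep_deviations\<close>), and \<open>E\<close> is independent of all surrogates; therefore \<open>S1\<close> and
  \<open>S2\<close> are independent. The division by the sample variance of \<open>H\<close> is harmless, as this variance
  is almost surely positive.
\<close>

section \<open>Independent families\<close>

context prob_space begin

text \<open>Independent blocks, each of them independent inside, make up an independent family: the
  events chosen from one block intersect in an event of that block, so the probability first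
  factors over the blocks and then inside each block. This is the converse of grouping the members
  of an independent family into blocks.\<close>

lemma indep_sets_UN_disjoint:
  assumes G: "indep_sets G I" and stable: "\<And>i. i \<in> I \<Longrightarrow> Int_stable (G i)"
    and disj: "disjoint_family_on J I"
    and F: "\<And>i. i \<in> I \<Longrightarrow> indep_sets F (J i)"
    and FG: "\<And>i j. i \<in> I \<Longrightarrow> j \<in> J i \<Longrightarrow> F j \<subseteq> G i"
  shows "indep_sets F (\<Union>i\<in>I. J i)"
proof (rule indep_setsI)
  fix j assume "j \<in> (\<Union>i\<in>I. J i)"
  then show "F j \<subseteq> events" using F by (auto simp: indep_sets_def)
next
  fix A K assume K: "K \<noteq> {}" "K \<subseteq> (\<Union>i\<in>I. J i)" "finite K" and A: "\<forall>j\<in>K. A j \<in> F j"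
  have "\<forall>k\<in>K. \<exists>i\<in>I. k \<in> J i" using K by auto
  then obtain b where b: "\<And>k. k \<in> K \<Longrightarrow> b k \<in> I \<and> k \<in> J (b k)" by metis
  define L where "L = b ` K"
  have L: "finite L" "L \<noteq> {}" "L \<subseteq> I" using K b by (auto simp: L_def)
  have Keq: "K = (\<Union>i\<in>L. K \<inter> J i)" using b by (auto simp: L_def)
  have ne: "K \<inter> J i \<noteq> {}" if "i \<in> L" for i using that b by (auto simp: L_def)
  have disjL: "(K \<inter> J i) \<inter> (K \<inter> J i') = {}" if "i \<in> L" "i' \<in> L" "i \<noteq> i'" for i i'
    using disj that L(3) by (auto simp: disjoint_family_on_def)
  have inG: "(\<Inter>k\<in>T. A k) \<in> G i" if "finite T" "T \<noteq> {}" "T \<subseteq> K \<inter> J i" "i \<in> L" for T i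
    using that
  proof (induction T rule: finite_ne_induct)
    case (singleton k)
    then show ?case using A FG[of i k] L(3) by auto
  next
    case (insert k T)
    then have "A k \<in> G i" using A FG[of i k] L(3) by auto
    with insert show ?case using stable[of i] L(3) by (auto simp: Int_stable_def)
  qed
  have "prob (\<Inter>k\<in>K. A k) = prob (\<Inter>i\<in>L. \<Inter>k\<in>K \<inter> J i. A k)"
    using Keq by (intro arg_cong[where f=prob]) blast
  also have "\<dots> = (\<Prod>i\<in>L. prob (\<Inter>k\<in>K \<inter> J i. A k))"
    using G L K ne inG by (intro indep_setsD[OF G]) auto
  also have "\<dots> = (\<Prod>i\<in>L. \<Prod>k\<in>K \<inter> J i. prob (A k))"
  proof (intro prod.cong refl)
    fix i assume "i \<in> L"
    then show "prob (\<Inter>k\<in>K \<inter> J i. A k) = (\<Prod>k\<in>K \<inter> J i. prob (A k))"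
      using K L ne A by (intro indep_setsD[OF F[of i]]) auto
  qed
  also have "\<dots> = (\<Prod>k\<in>(\<Union>i\<in>L. K \<inter> J i). prob (A k))"
    using L K disjL by (intro prod.UNION_disjoint[symmetric]) auto
  also have "\<dots> = (\<Prod>k\<in>K. prob (A k))" using Keq by simp
  finally show "prob (\<Inter>k\<in>K. A k) = (\<Prod>k\<in>K. prob (A k))" .
qed

lemma indep_vars_UN_disjoint:
  assumes G: "indep_sets G I" and stable: "\<And>i. i \<in> I \<Longrightarrow> Int_stable (G i)"
    and disj: "disjoint_family_on J I"
    and X: "\<And>i. i \<in> I \<Longrightarrow> indep_vars M' X (J i)"
    and XG: "\<And>i j A. i \<in> I \<Longrightarrow> j \<in> J i \<Longrightarrow> A \<in> sets (M' j) \<Longrightarrow> X j -` A \<inter> space M \<in> G i"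
  shows "indep_vars M' X (\<Union>i\<in>I. J i)"
  unfolding indep_vars_def2
proof
  show "\<forall>i\<in>\<Union> (J ` I). random_variable (M' i) (X i)"
    using X by (auto simp: indep_vars_def2)
  show "indep_sets (\<lambda>i. {X i -` A \<inter> space M |A. A \<in> sets (M' i)}) (\<Union> (J ` I))"
    by (rule indep_sets_UN_disjoint[OF G stable disj])
       (use X XG in \<open>auto simp: indep_vars_def2\<close>)
qed

lemma indep_vars_reindex:
  assumes f: "inj_on f I"
  shows "indep_vars M' X (f ` I) \<longleftrightarrow> indep_vars (\<lambda>i. M' (f i)) (\<lambda>i. X (f i)) I"
proof -
  have "indep_sets F (f ` I) \<longleftrightarrow> indep_sets (\<lambda>i. F (f i)) I" (is "?l \<longleftrightarrow> ?r") for F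
  proof
    assume l: ?l
    show ?r
    proof (rule indep_setsI)
      fix i assume "i \<in> I" then show "F (f i) \<subseteq> events" using l by (auto simp: indep_sets_def)
    next
      fix A J assume J: "J \<noteq> {}" "J \<subseteq> I" "finite J" and A: "\<forall>j\<in>J. A j \<in> F (f j)"
      have inj: "inj_on f J" using f J inj_on_subset by blast
      have [simp]: "the_inv_into J f (f j) = j" if "j \<in> J" for j
        using inj that by (rule the_inv_into_f_f)
      have "prob (\<Inter>k\<in>f ` J. A (the_inv_into J f k)) = (\<Prod>k\<in>f ` J. prob (A (the_inv_into J f k)))"
        using J A by (intro indep_setsD[OF l]) auto
      also have "(\<Inter>k\<in>f ` J. A (the_inv_into J f k)) = (\<Inter>j\<in>J. A j)" by auto
      also have "(\<Prod>k\<in>f ` J. prob (A (the_inv_into J f k))) = (\<Prod>j\<in>J. prob (A j))"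
        by (subst prod.reindex[OF inj]) (auto intro!: prod.cong)
      finally show "prob (\<Inter>j\<in>J. A j) = (\<Prod>j\<in>J. prob (A j))" .
    qed
  next
    assume r: ?r
    show ?l
    proof (rule indep_setsI)
      fix i assume "i \<in> f ` I" then show "F i \<subseteq> events" using r by (auto simp: indep_sets_def)
    next
      fix A K assume K: "K \<noteq> {}" "K \<subseteq> f ` I" "finite K" and A: "\<forall>j\<in>K. A j \<in> F j"
      then obtain J where J: "J \<subseteq> I" "K = f ` J" by (auto simp: subset_image_iff)
      have inj: "inj_on f J" using f J inj_on_subset by blast
      have "prob (\<Inter>j\<in>J. A (f j)) = (\<Prod>j\<in>J. prob (A (f j)))"
        using J A K inj by (intro indep_setsD[OF r]) (auto simp: finite_image_iff)
      then show "prob (\<Inter>j\<in>K. A j) = (\<Prod>j\<in>K. prob (A j))"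
        unfolding J by (simp add: prod.reindex[OF inj])
    qed
  qed
  then show ?thesis by (auto simp: indep_vars_def2)
qed

lemma indep_vars_doubleton:
  assumes ind: "indep_var (M' i) (X i) (M' j) (X j)" and "i \<noteq> j"
  shows "indep_vars M' X {i, j}"
  unfolding indep_vars_def2
proof
  show "\<forall>k\<in>{i, j}. random_variable (M' k) (X k)"
    using indep_var_rv1[OF ind] indep_var_rv2[OF ind] by auto
  then have ev: "X k -` A \<inter> space M \<in> events" if "k \<in> {i, j}" "A \<in> sets (M' k)" for k A
    using that by (auto intro: measurable_sets)
  have ij: "prob (a \<inter> b) = prob a * prob b"
    if "a \<in> {X i -` A \<inter> space M |A. A \<in> sets (M' i)}" "b \<in> {X j -` A \<inter> space M |A. A \<in> sets (M' j)}"
    for a b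
    using that ind unfolding indep_var_eq indep_sets2_eq by (auto intro!: sigma_sets.Basic)
  show "indep_sets (\<lambda>k. {X k -` A \<inter> space M |A. A \<in> sets (M' k)}) {i, j}"
  proof (rule indep_setsI)
    fix k assume "k \<in> {i, j}"
    then show "{X k -` A \<inter> space M |A. A \<in> sets (M' k)} \<subseteq> events" using ev by blast
  next
    fix A K assume K: "K \<noteq> {}" "K \<subseteq> {i, j}" 
      and A: "\<forall>k\<in>K. A k \<in> {X k -` A \<inter> space M |A. A \<in> sets (M' k)}"
    from K consider "K = {i}" | "K = {j}" | "K = {i, j}" by blast
    then show "prob (\<Inter>k\<in>K. A k) = (\<Prod>k\<in>K. prob (A k))"
    proof cases
      case 3
      then have "A i \<in> {X i -` A \<inter> space M |A. A \<in> sets (M' i)}"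
        "A j \<in> {X j -` A \<inter> space M |A. A \<in> sets (M' j)}" using A by blast+
      from ij[OF this] show ?thesis using 3 \<open>i \<noteq> j\<close> by simp
    qed auto
  qed
qed

section \<open>Independence of variables of different types\<close>

text \<open>The two variables may have values in different types, as a mean and a vector of deviations do.
  On a common type the relation is \<open>indep_var\<close>.\<close>

definition indep_rv :: "'b measure \<Rightarrow> ('a \<Rightarrow> 'b) \<Rightarrow> 'c measure \<Rightarrow> ('a \<Rightarrow> 'c) \<Rightarrow> bool" where
  "indep_rv S X T Y \<longleftrightarrow> random_variable S X \<and> random_variable T Y \<and>
     distr M S X \<Otimes>\<^sub>M distr M T Y = distr M (S \<Otimes>\<^sub>M T) (\<lambda>\<omega>. (X \<omega>, Y \<omega>))"

lemma indep_var_iff_indep_rv: "indep_var S X T Y \<longleftrightarrow> indep_rv S X T Y"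
  unfolding indep_var_distribution_eq indep_rv_def ..

lemma indep_rvD:
  assumes "indep_rv S X T Y"
  shows "random_variable S X" "random_variable T Y"
    "distr M (S \<Otimes>\<^sub>M T) (\<lambda>\<omega>. (X \<omega>, Y \<omega>)) = distr M S X \<Otimes>\<^sub>M distr M T Y"
  using assms by (simp_all add: indep_rv_def)

lemma indep_rv_rectangle:
  "indep_rv S X T Y \<longleftrightarrow> random_variable S X \<and> random_variable T Y \<and>
    (\<forall>A\<in>sets S. \<forall>B\<in>sets T. prob ((X -` A \<inter> space M) \<inter> (Y -` B \<inter> space M))
       = prob (X -` A \<inter> space M) * prob (Y -` B \<inter> space M))"
  (is "?l \<longleftrightarrow> ?X \<and> ?Y \<and> ?r")
proof (cases "?X \<and> ?Y")
  case True
  then have [measurable]: "random_variable S X" "random_variable T Y" by auto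
  interpret X: prob_space "distr M S X" by (rule prob_space_distr) fact
  interpret Y: prob_space "distr M T Y" by (rule prob_space_distr) fact
  have vim: "(\<lambda>\<omega>. (X \<omega>, Y \<omega>)) -` (A \<times> B) \<inter> space M = (X -` A \<inter> space M) \<inter> (Y -` B \<inter> space M)" for A B
    by auto
  have joint: "emeasure (distr M (S \<Otimes>\<^sub>M T) (\<lambda>\<omega>. (X \<omega>, Y \<omega>))) (A \<times> B)
      = prob ((X -` A \<inter> space M) \<inter> (Y -` B \<inter> space M))"
    and marginals: "emeasure (distr M S X) A * emeasure (distr M T Y) B
      = prob (X -` A \<inter> space M) * prob (Y -` B \<inter> space M)"
    if "A \<in> sets S" "B \<in> sets T" for A B
    using that by (simp_all add: emeasure_distr vim emeasure_eq_measure ennreal_mult)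
  have "?l \<longleftrightarrow> ?r"
  proof
    assume ?l
    show ?r
    proof (intro ballI)
      fix A B assume AB: "A \<in> sets S" "B \<in> sets T"
      have "ennreal (prob ((X -` A \<inter> space M) \<inter> (Y -` B \<inter> space M))) =
            ennreal (prob (X -` A \<inter> space M) * prob (Y -` B \<inter> space M))"
        using AB unfolding joint[OF AB, symmetric] indep_rvD(3)[OF \<open>?l\<close>]
        by (subst Y.emeasure_pair_measure_Times) (simp_all add: marginals)
      then show "prob ((X -` A \<inter> space M) \<inter> (Y -` B \<inter> space M)) =
            prob (X -` A \<inter> space M) * prob (Y -` B \<inter> space M)" by simp
    qed
  next
    assume ?r
    have "distr M S X \<Otimes>\<^sub>M distr M T Y = distr M (S \<Otimes>\<^sub>M T) (\<lambda>\<omega>. (X \<omega>, Y \<omega>))"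
    proof (rule pair_measure_eqI)
      show "sets (distr M S X \<Otimes>\<^sub>M distr M T Y) = sets (distr M (S \<Otimes>\<^sub>M T) (\<lambda>\<omega>. (X \<omega>, Y \<omega>)))"
        unfolding sets_distr by (intro sets_pair_measure_cong sets_distr)
      fix A B assume "A \<in> sets (distr M S X)" "B \<in> sets (distr M T Y)"
      then show "emeasure (distr M S X) A * emeasure (distr M T Y) B
          = emeasure (distr M (S \<Otimes>\<^sub>M T) (\<lambda>\<omega>. (X \<omega>, Y \<omega>))) (A \<times> B)"
        using \<open>?r\<close> by (simp add: joint marginals)
    qed (rule X.sigma_finite_measure_axioms Y.sigma_finite_measure_axioms)+
    then show ?l by (simp add: indep_rv_def)
  qed
  then show ?thesis using True by blast
qed (auto simp: indep_rv_def)

lemma indep_rv_compose: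
  assumes ind: "indep_rv S X T Y" and f: "f \<in> measurable S S'" and g: "g \<in> measurable T T'"
  shows "indep_rv S' (\<lambda>\<omega>. f (X \<omega>)) T' (\<lambda>\<omega>. g (Y \<omega>))"
proof -
  note rv = indep_rvD(1,2)[OF ind]
  have vim: "(\<lambda>\<omega>. h (W \<omega>)) -` A \<inter> space M = W -` (h -` A \<inter> space U) \<inter> space M"
    if "random_variable U W" for h W A U
    using measurable_space[OF that] by auto
  show ?thesis
    using ind rv f g unfolding indep_rv_rectangle vim[OF rv(1)] vim[OF rv(2)]
    by (auto intro: measurable_compose measurable_sets simp del: vimage_Int)
qed

lemma indep_rv_sym: "indep_rv S X T Y \<Longrightarrow> indep_rv T Y S X"
  unfolding indep_rv_rectangle by (auto simp: Int_commute mult.commute)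

lemma indep_rv_const:
  assumes "random_variable S X" and "c \<in> space T"
  shows "indep_rv S X T (\<lambda>_. c)"
proof -
  have "(\<lambda>_. c) -` B \<inter> space M = (if c \<in> B then space M else {})" for B by auto
  then show ?thesis using assms by (auto simp: indep_rv_rectangle prob_space Int_assoc)
qed

text \<open>Both hypotheses together say that \<open>X\<close>, \<open>Y\<close>, \<open>Z\<close> are mutually independent. The joint law is
  \<open>(PX \<otimes> PY) \<otimes> PZ\<close>, and integrating out \<open>Z\<close> first leaves an integrand in which \<open>x\<close> and \<open>y\<close>
  are separated.\<close>

lemma indep_rv_assoc:
  assumes XY: "indep_rv S X T Y" and XYZ: "indep_rv (S \<Otimes>\<^sub>M T) (\<lambda>\<omega>. (X \<omega>, Y \<omega>)) U Z"
  shows "indep_rv S X (T \<Otimes>\<^sub>M U) (\<lambda>\<omega>. (Y \<omega>, Z \<omega>))"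
proof -
  note [measurable] = indep_rvD(1,2)[OF XY] indep_rvD(2)[OF XYZ]
  let ?PX = "distr M S X" and ?PY = "distr M T Y" and ?PZ = "distr M U Z"
  interpret X: prob_space ?PX by (rule prob_space_distr) simp
  interpret Y: prob_space ?PY by (rule prob_space_distr) simp
  interpret Z: prob_space ?PZ by (rule prob_space_distr) simp
  have YZ: "distr M (T \<Otimes>\<^sub>M U) (\<lambda>\<omega>. (Y \<omega>, Z \<omega>)) = ?PY \<Otimes>\<^sub>M ?PZ"
    using indep_rvD(3)[OF indep_rv_compose[OF XYZ measurable_snd measurable_ident]] by simp
  have "distr M S X \<Otimes>\<^sub>M distr M (T \<Otimes>\<^sub>M U) (\<lambda>\<omega>. (Y \<omega>, Z \<omega>))
      = distr M (S \<Otimes>\<^sub>M (T \<Otimes>\<^sub>M U)) (\<lambda>\<omega>. (X \<omega>, Y \<omega>, Z \<omega>))"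
  proof (rule pair_measure_eqI)
    fix A B assume "A \<in> sets ?PX" and "B \<in> sets (distr M (T \<Otimes>\<^sub>M U) (\<lambda>\<omega>. (Y \<omega>, Z \<omega>)))"
    then have [measurable]: "A \<in> sets S" "B \<in> sets (T \<Otimes>\<^sub>M U)" by auto
    have [measurable]: "(\<lambda>y. emeasure ?PZ (Pair y -` B)) \<in> borel_measurable T"
      using Z.measurable_emeasure_Pair[of B ?PY] by (simp cong: measurable_cong_sets sets_pair_measure_cong)
    \<comment> \<open>the event \<open>A \<times> B\<close> with its coordinates bracketed as \<open>((x, y), z)\<close>\<close>
    let ?Q = "{p \<in> space ((S \<Otimes>\<^sub>M T) \<Otimes>\<^sub>M U). fst (fst p) \<in> A \<and> (snd (fst p), snd p) \<in> B}"
    have Q: "?Q \<in> sets ((S \<Otimes>\<^sub>M T) \<Otimes>\<^sub>M U)" by measurable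
    have "emeasure (distr M (S \<Otimes>\<^sub>M (T \<Otimes>\<^sub>M U)) (\<lambda>\<omega>. (X \<omega>, Y \<omega>, Z \<omega>))) (A \<times> B)
        = emeasure (distr M ((S \<Otimes>\<^sub>M T) \<Otimes>\<^sub>M U) (\<lambda>\<omega>. ((X \<omega>, Y \<omega>), Z \<omega>))) ?Q"
    proof -
      have "(\<lambda>\<omega>. (X \<omega>, Y \<omega>, Z \<omega>)) -` (A \<times> B) \<inter> space M
          = (\<lambda>\<omega>. ((X \<omega>, Y \<omega>), Z \<omega>)) -` ?Q \<inter> space M"
        using measurable_space[OF indep_rvD(1)[OF XY]] measurable_space[OF indep_rvD(2)[OF XY]]
          measurable_space[OF indep_rvD(2)[OF XYZ]] by (auto simp: space_pair_measure)
      then show ?thesis using Q by (simp add: emeasure_distr)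
    qed
    also have "\<dots> = emeasure ((?PX \<Otimes>\<^sub>M ?PY) \<Otimes>\<^sub>M ?PZ) ?Q"
      using indep_rvD(3)[OF XYZ] indep_rvD(3)[OF XY] by simp
    also have "\<dots> = (\<integral>\<^sup>+p. emeasure ?PZ (Pair p -` ?Q) \<partial>(?PX \<Otimes>\<^sub>M ?PY))"
      using Q by (intro Z.emeasure_pair_measure_alt) (simp cong: sets_pair_measure_cong)
    also have "\<dots> = (\<integral>\<^sup>+p. indicator A (fst p) * emeasure ?PZ (Pair (snd p) -` B) \<partial>(?PX \<Otimes>\<^sub>M ?PY))"
    proof (intro nn_integral_cong)
      fix p assume p: "p \<in> space (?PX \<Otimes>\<^sub>M ?PY)"
      have "Pair p -` ?Q = (if fst p \<in> A then Pair (snd p) -` B else {})"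
        using p sets.sets_into_space[OF \<open>B \<in> sets (T \<Otimes>\<^sub>M U)\<close>]
        by (auto simp: space_pair_measure)
      then show "emeasure ?PZ (Pair p -` ?Q) = indicator A (fst p) * emeasure ?PZ (Pair (snd p) -` B)"
        by simp
    qed
    also have "\<dots> = (\<integral>\<^sup>+x. \<integral>\<^sup>+y. indicator A x * emeasure ?PZ (Pair y -` B) \<partial>?PY \<partial>?PX)"
      using Y.nn_integral_fst[of "\<lambda>p. indicator A (fst p) * emeasure ?PZ (Pair (snd p) -` B)" ?PX]
      by simp
    also have "\<dots> = (\<integral>\<^sup>+x. indicator A x * (\<integral>\<^sup>+y. emeasure ?PZ (Pair y -` B) \<partial>?PY) \<partial>?PX)"
      by (intro nn_integral_cong nn_integral_cmult) simp
    also have "\<dots> = emeasure ?PX A * (\<integral>\<^sup>+y. emeasure ?PZ (Pair y -` B) \<partial>?PY)"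
      by (subst nn_integral_multc) simp_all
    also have "(\<integral>\<^sup>+y. emeasure ?PZ (Pair y -` B) \<partial>?PY) = emeasure (?PY \<Otimes>\<^sub>M ?PZ) B"
      by (intro Z.emeasure_pair_measure_alt[symmetric]) (simp add: sets_distr cong: sets_pair_measure_cong)
    finally show "emeasure ?PX A * emeasure (distr M (T \<Otimes>\<^sub>M U) (\<lambda>\<omega>. (Y \<omega>, Z \<omega>))) B =
      emeasure (distr M (S \<Otimes>\<^sub>M (T \<Otimes>\<^sub>M U)) (\<lambda>\<omega>. (X \<omega>, Y \<omega>, Z \<omega>))) (A \<times> B)" unfolding YZ by simp
  next
    show "sigma_finite_measure ?PX" by (rule X.sigma_finite_measure_axioms)
    show "sigma_finite_measure (distr M (T \<Otimes>\<^sub>M U) (\<lambda>\<omega>. (Y \<omega>, Z \<omega>)))"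
      by (intro prob_space_imp_sigma_finite prob_space_distr) simp
    show "sets (?PX \<Otimes>\<^sub>M distr M (T \<Otimes>\<^sub>M U) (\<lambda>\<omega>. (Y \<omega>, Z \<omega>)))
        = sets (distr M (S \<Otimes>\<^sub>M (T \<Otimes>\<^sub>M U)) (\<lambda>\<omega>. (X \<omega>, Y \<omega>, Z \<omega>)))"
      unfolding sets_distr by (intro sets_pair_measure_cong sets_distr)
  qed
  then show ?thesis by (simp add: indep_rv_def)
qed

end

section \<open>Shears of planar densities\<close>

text \<open>On every horizontal line the shear is a translation.\<close>

lemma distr_lborel_shear:
  fixes g :: "real \<Rightarrow> real"
  assumes [measurable]: "g \<in> borel_measurable borel"
  shows "distr (lborel \<Otimes>\<^sub>M lborel) (lborel \<Otimes>\<^sub>M lborel) (\<lambda>(x, y). (x + g y, y))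
    = lborel \<Otimes>\<^sub>M (lborel :: real measure)"
proof (rule measure_eqI)
  fix A assume "A \<in> sets (distr (lborel \<Otimes>\<^sub>M lborel) (lborel \<Otimes>\<^sub>M lborel) (\<lambda>(x, y). (x + g y, y)))"
  then have A: "A \<in> sets (lborel \<Otimes>\<^sub>M lborel)" by simp
  then have [measurable]: "A \<in> sets (borel \<Otimes>\<^sub>M borel)" by (simp cong: sets_pair_measure_cong)
  have meas: "(\<lambda>(x, y). (x + g y, y)) \<in> measurable (lborel \<Otimes>\<^sub>M lborel) (lborel \<Otimes>\<^sub>M lborel)"
    by measurable
  have "emeasure (distr (lborel \<Otimes>\<^sub>M lborel) (lborel \<Otimes>\<^sub>M lborel) (\<lambda>(x, y). (x + g y, y))) A
      = (\<integral>\<^sup>+p. indicator A (fst p + g (snd p), snd p) \<partial>(lborel \<Otimes>\<^sub>M lborel))"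
    using A meas
    by (simp add: nn_integral_indicator[symmetric] nn_integral_distr case_prod_beta del: nn_integral_indicator)
  also have "\<dots> = (\<integral>\<^sup>+y. \<integral>\<^sup>+x. indicator A (x + g y, y) \<partial>lborel \<partial>lborel)"
    by (subst lborel_pair.nn_integral_snd[symmetric]) simp_all
  also have "\<dots> = (\<integral>\<^sup>+y. \<integral>\<^sup>+x. indicator A (x, y) \<partial>lborel \<partial>lborel)"
  proof (rule nn_integral_cong)
    fix y :: real
    show "(\<integral>\<^sup>+x. indicator A (x + g y, y) \<partial>lborel) = (\<integral>\<^sup>+x. indicator A (x, y) \<partial>lborel)"
      by (subst (2) nn_integral_real_affine[where c=1 and t="g y"]) (simp_all add: add.commute)
  qed
  also have "\<dots> = (\<integral>\<^sup>+p. indicator A p \<partial>(lborel \<Otimes>\<^sub>M lborel))"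
    by (subst lborel_pair.nn_integral_snd[symmetric]) simp_all
  finally show "emeasure (distr (lborel \<Otimes>\<^sub>M lborel) (lborel \<Otimes>\<^sub>M lborel) (\<lambda>(x, y). (x + g y, y))) A
      = emeasure (lborel \<Otimes>\<^sub>M lborel) A" using A by simp
qed simp

text \<open>The joint density of independent \<open>X \<sim> N(m1, s\<^sup>2)\<close> and \<open>Y \<sim> N(m2, t\<^sup>2)\<close>, expressed in the
  coordinates \<open>x = X + q (Y - X)\<close> and \<open>y = Y - X\<close>. With \<open>q = s\<^sup>2 / (s\<^sup>2 + t\<^sup>2)\<close> these are
  uncorrelated, so the mixed term of the exponent vanishes.\<close>

lemma normal_density_mult_weighted_mean_difference:
  fixes s t :: real
  assumes "0 < s" "0 < t"
  defines "q \<equiv> s\<^sup>2 / (s\<^sup>2 + t\<^sup>2)"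
  shows "normal_density m1 s (x - q * y) * normal_density m2 t (x + (1 - q) * y)
    = normal_density (m1 + q * (m2 - m1)) (s * t / sqrt (s\<^sup>2 + t\<^sup>2)) x * normal_density (m2 - m1) (sqrt (s\<^sup>2 + t\<^sup>2)) y"
proof -
  define S where "S = s\<^sup>2 + t\<^sup>2"
  have pos: "0 < S" using assms by (simp add: S_def add_pos_pos)
  have nz: "s\<^sup>2 \<noteq> 0" "t\<^sup>2 \<noteq> 0" "s \<noteq> 0" "t \<noteq> 0" "S \<noteq> 0" using assms pos by auto
  define a d where "a = x - (m1 + q * (m2 - m1))" and "d = y - (m2 - m1)"
  have x: "x - q * y - m1 = a - q * d" "x + (1 - q) * y - m2 = a + (1 - q) * d"
    by (simp_all add: a_def d_def algebra_simps)
  have q: "q = s\<^sup>2 / S" "1 - q = t\<^sup>2 / S" using nz by (simp_all add: q_def S_def diff_divide_eq_iff)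
  have sq: "(a - u / S * d)\<^sup>2 / (2 * u) = a\<^sup>2 / (2 * u) - a * d / S + u * d\<^sup>2 / (2 * S\<^sup>2)" if "u \<noteq> 0" for u
    using that nz by (simp add: field_simps power2_eq_square)
  have "(a + t\<^sup>2 / S * d)\<^sup>2 / (2 * t\<^sup>2) = a\<^sup>2 / (2 * t\<^sup>2) + a * d / S + t\<^sup>2 * d\<^sup>2 / (2 * S\<^sup>2)"
    using nz by (simp add: field_simps power2_eq_square)
  then have "(a - q * d)\<^sup>2 / (2 * s\<^sup>2) + (a + (1 - q) * d)\<^sup>2 / (2 * t\<^sup>2)
      = (a\<^sup>2 / (2 * s\<^sup>2) + a\<^sup>2 / (2 * t\<^sup>2)) + (s\<^sup>2 + t\<^sup>2) * d\<^sup>2 / (2 * S\<^sup>2)"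
    unfolding q(2) using sq[OF nz(1)] unfolding q(1) by (simp add: add_divide_distrib distrib_right)
  also have "a\<^sup>2 / (2 * s\<^sup>2) + a\<^sup>2 / (2 * t\<^sup>2) = a\<^sup>2 / (2 * (s * t / sqrt S)\<^sup>2)"
  proof -
    have "a\<^sup>2 / (2 * u) + a\<^sup>2 / (2 * v) = a\<^sup>2 / (2 * (u * v / (u + v)))" if "0 < u" "0 < v" for u v :: real
      using that by (simp add: field_simps)
    then show ?thesis using assms(1,2) pos by (simp add: power_divide power_mult_distrib S_def)
  qed
  also have "(s\<^sup>2 + t\<^sup>2) * d\<^sup>2 / (2 * S\<^sup>2) = d\<^sup>2 / (2 * (sqrt S)\<^sup>2)"
    using nz pos unfolding S_def[symmetric] by (simp add: power2_eq_square)
  finally have e: "(a - q * d)\<^sup>2 / (2 * s\<^sup>2) + (a + (1 - q) * d)\<^sup>2 / (2 * t\<^sup>2)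
      = a\<^sup>2 / (2 * (s * t / sqrt S)\<^sup>2) + d\<^sup>2 / (2 * (sqrt S)\<^sup>2)" .
  have c: "sqrt (2 * pi * s\<^sup>2) * sqrt (2 * pi * t\<^sup>2) = sqrt (2 * pi * (s * t / sqrt S)\<^sup>2) * sqrt (2 * pi * (sqrt S)\<^sup>2)"
    using pos nz by (simp add: real_sqrt_mult[symmetric] power_divide power_mult_distrib)
  have e': "exp (- (a - q * d)\<^sup>2 / (2 * s\<^sup>2)) * exp (- (a + (1 - q) * d)\<^sup>2 / (2 * t\<^sup>2))
      = exp (- a\<^sup>2 / (2 * (s * t / sqrt S)\<^sup>2)) * exp (- d\<^sup>2 / (2 * (sqrt S)\<^sup>2))"
    using e unfolding exp_add[symmetric] minus_divide_left[symmetric] by simp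
  have regroup: "1 / u * e1 * (1 / v * e2) = 1 / (u * v) * (e1 * e2)" for u v e1 e2 :: real by simp
  show ?thesis
    unfolding normal_density_def S_def[symmetric] x a_def[symmetric] d_def[symmetric] regroup e' c ..
qed

context prob_space begin

text \<open>The density is only transported: a shear has Jacobian 1.\<close>

lemma distributed_shear:
  fixes X Y :: "'a \<Rightarrow> real" and f :: "real \<times> real \<Rightarrow> ennreal"
  assumes XY: "distributed M (lborel \<Otimes>\<^sub>M lborel) (\<lambda>\<omega>. (X \<omega>, Y \<omega>)) f"
    and g[measurable]: "g \<in> borel_measurable borel"
  shows "distributed M (lborel \<Otimes>\<^sub>M lborel) (\<lambda>\<omega>. (X \<omega> - g (Y \<omega>), Y \<omega>)) (\<lambda>(x, y). f (x + g y, y))"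
proof -
  let ?L = "lborel \<Otimes>\<^sub>M lborel :: (real \<times> real) measure"
  let ?T = "\<lambda>(x, y). (x - g y, y)"
  have T: "?T \<in> measurable ?L ?L" by measurable
  have "(\<lambda>p. (fst p + g (snd p), snd p)) \<in> measurable ?L ?L" by measurable
  from measurable_compose[OF this distributed_borel_measurable[OF XY]]
  have T': "(\<lambda>(x, y). f (x + g y, y)) \<in> borel_measurable ?L" unfolding case_prod_beta .
  have shear: "distr ?L ?L ?T = ?L" using distr_lborel_shear[of "\<lambda>y. - g y"] by simp
  have "distr M ?L (\<lambda>\<omega>. (X \<omega> - g (Y \<omega>), Y \<omega>)) = distr (distr M ?L (\<lambda>\<omega>. (X \<omega>, Y \<omega>))) ?L ?T"
    by (subst distr_distr[OF T distributed_measurable[OF XY]]) (simp add: o_def)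
  also have "\<dots> = distr (density ?L f) ?L ?T" by (simp add: distributed_distr_eq_density[OF XY])
  also have "\<dots> = distr (density ?L (\<lambda>p. (\<lambda>(x, y). f (x + g y, y)) (?T p))) ?L ?T"
    by (simp add: case_prod_beta)
  also have "\<dots> = density (distr ?L ?L ?T) (\<lambda>(x, y). f (x + g y, y))"
    by (rule density_distr[OF T' T, symmetric])
  finally show ?thesis
    unfolding distributed_def shear
    using T' measurable_compose[OF distributed_measurable[OF XY] T] by simp
qed

text \<open>Since both factors are normalised, the law with the product density is a product of two
  probability measures, and these have to be the marginals.\<close>

lemma distributed_product:
  fixes X Y :: "'a \<Rightarrow> real" and f g :: "real \<Rightarrow> ennreal"
  assumes XY: "distributed M (lborel \<Otimes>\<^sub>M lborel) (\<lambda>\<omega>. (X \<omega>, Y \<omega>)) (\<lambda>(x, y). f x * g y)"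
    and [measurable]: "f \<in> borel_measurable lborel" "g \<in> borel_measurable lborel"
    and f: "prob_space (density lborel f)" and g: "prob_space (density lborel g)"
  shows "indep_rv borel X borel Y" "distributed M lborel X f" "distributed M lborel Y g"
proof -
  let ?L = "lborel \<Otimes>\<^sub>M lborel :: (real \<times> real) measure"
  interpret F: prob_space "density lborel f" by fact
  interpret G: prob_space "density lborel g" by fact
  have rv: "(\<lambda>\<omega>. (X \<omega>, Y \<omega>)) \<in> measurable M ?L" using distributed_measurable[OF XY] .
  have [measurable]: "random_variable borel X" "random_variable borel Y"
    using measurable_compose[OF rv measurable_fst] measurable_compose[OF rv measurable_snd] by simp_all
  have law: "distr M ?L (\<lambda>\<omega>. (X \<omega>, Y \<omega>)) = density lborel f \<Otimes>\<^sub>M density lborel g"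
    unfolding distributed_distr_eq_density[OF XY]
    by (intro pair_measure_density[symmetric] lborel.sigma_finite_measure_axioms
        G.sigma_finite_measure_axioms) simp_all
  have X: "distr M lborel X = density lborel f"
  proof -
    have "distr M lborel X = distr (distr M ?L (\<lambda>\<omega>. (X \<omega>, Y \<omega>))) lborel fst"
      by (subst distr_distr) (simp_all add: o_def rv)
    also have "\<dots> = distr (density lborel f \<Otimes>\<^sub>M density lborel g) (density lborel f) fst"
      unfolding law by (rule distr_cong) simp_all
    finally show ?thesis by (simp add: G.distr_pair_fst)
  qed
  have Y: "distr M lborel Y = density lborel g"
  proof -
    have "distr M lborel Y = distr (distr M ?L (\<lambda>\<omega>. (X \<omega>, Y \<omega>))) lborel snd"
      by (subst distr_distr) (simp_all add: o_def rv)
    also have "\<dots> = distr (density lborel f \<Otimes>\<^sub>M density lborel g) (density lborel g) snd"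
      unfolding law by (rule distr_cong) simp_all
    also have "\<dots> = density lborel g"
    proof (rule measure_eqI)
      fix A assume "A \<in> sets (distr (density lborel f \<Otimes>\<^sub>M density lborel g) (density lborel g) snd)"
      then have A: "A \<in> sets borel" by simp
      have "snd -` A \<inter> space (density lborel f \<Otimes>\<^sub>M density lborel g) = space (density lborel f) \<times> A"
        by (auto simp: space_pair_measure)
      then show "emeasure (distr (density lborel f \<Otimes>\<^sub>M density lborel g) (density lborel g) snd) A
          = emeasure (density lborel g) A"
        using A by (subst emeasure_distr) (simp_all add: G.emeasure_pair_measure_Times[OF sets.top] F.emeasure_space_1 del: space_density)
    qed simp
    finally show ?thesis .
  qed
  show "distributed M lborel X f" "distributed M lborel Y g"
    unfolding distributed_def using X Y by simp_all
  have [simp]: "distr M borel X = distr M lborel X" "distr M borel Y = distr M lborel Y"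
    by (rule distr_cong; simp)+
  have "distr M (borel \<Otimes>\<^sub>M borel) (\<lambda>\<omega>. (X \<omega>, Y \<omega>)) = distr M ?L (\<lambda>\<omega>. (X \<omega>, Y \<omega>))"
    by (rule distr_cong) (simp_all cong: sets_pair_measure_cong)
  then show "indep_rv borel X borel Y" unfolding indep_rv_def by (simp add: law X Y)
qed

section \<open>Normal variables\<close>

text \<open>Summands of weight 0 are dropped before the addition theorem for normal densities is applied,
  since they have no density; one nonzero weight has to remain.\<close>

lemma normal_linear_combination:
  fixes X :: "'i \<Rightarrow> 'a \<Rightarrow> real"
  assumes "finite I" and ind: "indep_vars (\<lambda>_. borel) X I"
    and s: "\<And>i. i \<in> I \<Longrightarrow> 0 < s i"
    and X: "\<And>i. i \<in> I \<Longrightarrow> distributed M lborel (X i) (normal_density (m i) (s i))"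
    and w: "j \<in> I" "w j \<noteq> 0"
  shows "distributed M lborel (\<lambda>\<omega>. \<Sum>i\<in>I. w i * X i \<omega>)
    (normal_density (\<Sum>i\<in>I. w i * m i) (sqrt (\<Sum>i\<in>I. (w i * s i)\<^sup>2)))"
proof -
  define J where "J = {i\<in>I. w i \<noteq> 0}"
  have J: "finite J" "J \<noteq> {}" "J \<subseteq> I" using assms by (auto simp: J_def)
  have sum_J: "(\<Sum>i\<in>I. f i) = (\<Sum>i\<in>J. f i)" if "\<And>i. i \<in> I \<Longrightarrow> w i = 0 \<Longrightarrow> f i = 0"
    for f :: "'i \<Rightarrow> real"
    using that \<open>finite I\<close> by (intro sum.mono_neutral_right) (auto simp: J_def)
  have "distributed M lborel (\<lambda>\<omega>. \<Sum>i\<in>J. w i * X i \<omega>)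
      (normal_density (\<Sum>i\<in>J. w i * m i) (sqrt (\<Sum>i\<in>J. (\<bar>w i\<bar> * s i)\<^sup>2)))"
  proof (rule sum_indep_normal)
    show "indep_vars (\<lambda>_. borel) (\<lambda>i \<omega>. w i * X i \<omega>) J"
      using indep_vars_compose2[OF indep_vars_subset[OF ind J(3)], of "\<lambda>i x. w i * x" "\<lambda>_. borel"] by simp
    fix i assume i: "i \<in> J"
    then show "0 < \<bar>w i\<bar> * s i" using s by (auto simp: J_def)
    show "distributed M lborel (\<lambda>\<omega>. w i * X i \<omega>) (normal_density (w i * m i) (\<bar>w i\<bar> * s i))"
      using normal_density_affine[OF X s, of i "w i" 0] i by (auto simp: J_def)
  qed (use J in auto)
  also have "(\<Sum>i\<in>J. w i * m i) = (\<Sum>i\<in>I. w i * m i)" by (rule sum_J[symmetric]) simp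
  also have "(\<Sum>i\<in>J. (\<bar>w i\<bar> * s i)\<^sup>2) = (\<Sum>i\<in>I. (w i * s i)\<^sup>2)"
    by (subst sum_J) (simp_all add: power_mult_distrib)
  also have "(\<lambda>\<omega>. \<Sum>i\<in>J. w i * X i \<omega>) = (\<lambda>\<omega>. \<Sum>i\<in>I. w i * X i \<omega>)"
    by (intro ext sum_J[symmetric]) simp
  finally show ?thesis .
qed

text \<open>Two shears lead from \<open>(X, Y)\<close> to the weighted mean and the difference: first \<open>Y\<close> is replaced
  by \<open>Y - X\<close>, then \<open>X\<close> by \<open>X + q (Y - X)\<close>. The resulting density is a product.\<close>

lemma indep_normal_weighted_mean_difference:
  assumes ind: "indep_rv borel X borel Y" and "0 < s" "0 < t"
    and X: "distributed M lborel X (normal_density m1 s)"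
    and Y: "distributed M lborel Y (normal_density m2 t)"
  shows "indep_rv borel (\<lambda>\<omega>. X \<omega> + s\<^sup>2 / (s\<^sup>2 + t\<^sup>2) * (Y \<omega> - X \<omega>)) borel (\<lambda>\<omega>. Y \<omega> - X \<omega>)"
proof -
  define q where "q = s\<^sup>2 / (s\<^sup>2 + t\<^sup>2)"
  have pos: "0 < s * t / sqrt (s\<^sup>2 + t\<^sup>2)" "0 < sqrt (s\<^sup>2 + t\<^sup>2)"
    using \<open>0 < s\<close> \<open>0 < t\<close> by (simp_all add: add_pos_pos)
  have "indep_rv lborel Y lborel X"
    using indep_rv_compose[OF indep_rv_sym[OF ind], of "\<lambda>x. x" lborel "\<lambda>x. x" lborel] by simp
  then have YX: "distributed M (lborel \<Otimes>\<^sub>M lborel) (\<lambda>\<omega>. (Y \<omega>, X \<omega>))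
      (\<lambda>(y, x). ennreal (normal_density m2 t y) * ennreal (normal_density m1 s x))"
    by (intro distributed_joint_indep' lborel.sigma_finite_measure_axioms X Y) (simp add: indep_rv_def)
  have DX: "distributed M (lborel \<Otimes>\<^sub>M lborel) (\<lambda>\<omega>. (Y \<omega> - X \<omega>, X \<omega>))
      (\<lambda>(d, x). ennreal (normal_density m2 t (d + x)) * ennreal (normal_density m1 s x))"
    using distributed_shear[OF YX, of "\<lambda>x. x"] by simp
  have XD: "distributed M (lborel \<Otimes>\<^sub>M lborel) (\<lambda>\<omega>. (X \<omega>, Y \<omega> - X \<omega>))
      (\<lambda>(x, d). ennreal (normal_density m2 t (d + x)) * ennreal (normal_density m1 s x))"
    using distributed_swap[OF lborel.sigma_finite_measure_axioms lborel.sigma_finite_measure_axioms DX]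
    by (simp add: case_prod_beta)
  have CD: "distributed M (lborel \<Otimes>\<^sub>M lborel) (\<lambda>\<omega>. (X \<omega> - (- q) * (Y \<omega> - X \<omega>), Y \<omega> - X \<omega>))
      (\<lambda>(c, d). ennreal (normal_density m2 t (d + (c + (- q) * d))) * ennreal (normal_density m1 s (c + (- q) * d)))"
    using distributed_shear[OF XD, of "\<lambda>d. (- q) * d"] by simp
  have "normal_density m2 t (d + (c + (- q) * d)) * normal_density m1 s (c + (- q) * d)
      = normal_density (m1 + q * (m2 - m1)) (s * t / sqrt (s\<^sup>2 + t\<^sup>2)) c
        * normal_density (m2 - m1) (sqrt (s\<^sup>2 + t\<^sup>2)) d" for c d
    using normal_density_mult_weighted_mean_difference[OF \<open>0 < s\<close> \<open>0 < t\<close>, of m1 c d m2]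
    unfolding q_def[symmetric] by (simp add: algebra_simps)
  then have "distributed M (lborel \<Otimes>\<^sub>M lborel) (\<lambda>\<omega>. (X \<omega> + q * (Y \<omega> - X \<omega>), Y \<omega> - X \<omega>))
      (\<lambda>(c, d). ennreal (normal_density (m1 + q * (m2 - m1)) (s * t / sqrt (s\<^sup>2 + t\<^sup>2)) c)
        * ennreal (normal_density (m2 - m1) (sqrt (s\<^sup>2 + t\<^sup>2)) d))"
    using CD by (simp add: ennreal_mult''[symmetric] normal_density_nonneg)
  from distributed_product(1)[OF this] show ?thesis
    unfolding q_def[symmetric] using prob_space_normal_density pos by simp
qed

text \<open>Subtracting the regression line from \<open>X\<close> is a shear, and it completes the square in the
  exponent of the bivariate density.\<close>

lemma bivariate_normal_regression:
  fixes \<mu> \<mu>' \<sigma> \<sigma>' \<rho> :: real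
  assumes XY: "distributed M (lborel \<Otimes>\<^sub>M lborel) (\<lambda>\<omega>. (X \<omega>, Y \<omega>))
      (bivariate_normal_density \<mu> \<mu>' \<sigma> \<sigma>' \<rho>)"
    and "0 < \<sigma>" "0 < \<sigma>'" "-1 < \<rho>" "\<rho> < 1"
  defines "E \<equiv> \<lambda>\<omega>. X \<omega> - (\<mu> + \<rho> * \<sigma> / \<sigma>' * (Y \<omega> - \<mu>'))"
  shows "indep_rv borel E borel Y"
    and "distributed M lborel E (normal_density 0 (\<sigma> * sqrt (1 - \<rho>\<^sup>2)))"
    and "distributed M lborel Y (normal_density \<mu>' \<sigma>')"
proof -
  have \<rho>: "0 < 1 - \<rho>\<^sup>2" using \<open>-1 < \<rho>\<close> \<open>\<rho> < 1\<close> by (simp add: abs_square_less_1 abs_if)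
  then have pos: "0 < \<sigma> * sqrt (1 - \<rho>\<^sup>2)" using \<open>0 < \<sigma>\<close> by simp
  have EY: "distributed M (lborel \<Otimes>\<^sub>M lborel) (\<lambda>\<omega>. (E \<omega>, Y \<omega>))
      (\<lambda>(e, y). ennreal (bivariate_normal_density \<mu> \<mu>' \<sigma> \<sigma>' \<rho> (e + (\<mu> + \<rho> * \<sigma> / \<sigma>' * (y - \<mu>')), y)))"
    unfolding E_def using distributed_shear[OF XY, of "\<lambda>y. \<mu> + \<rho> * \<sigma> / \<sigma>' * (y - \<mu>')"] by simp
  have factor: "bivariate_normal_density \<mu> \<mu>' \<sigma> \<sigma>' \<rho> (e + (\<mu> + \<rho> * \<sigma> / \<sigma>' * (y - \<mu>')), y)
      = normal_density 0 (\<sigma> * sqrt (1 - \<rho>\<^sup>2)) e * normal_density \<mu>' \<sigma>' y" for e y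
  proof -
    define a b where "a = e / \<sigma>" and "b = (y - \<mu>') / \<sigma>'"
    have x: "(e + (\<mu> + \<rho> * \<sigma> / \<sigma>' * (y - \<mu>')) - \<mu>) / \<sigma> = a + \<rho> * b"
      using \<open>0 < \<sigma>\<close> \<open>0 < \<sigma>'\<close> by (simp add: a_def b_def field_simps)
    have "(a + \<rho> * b)\<^sup>2 - 2 * \<rho> * (a + \<rho> * b) * b + b\<^sup>2 = a\<^sup>2 + (1 - \<rho>\<^sup>2) * b\<^sup>2"
      by (simp add: power2_eq_square algebra_simps)
    then have "((a + \<rho> * b)\<^sup>2 - 2 * \<rho> * (a + \<rho> * b) * b + b\<^sup>2) / (2 * (1 - \<rho>\<^sup>2))
        = a\<^sup>2 / (2 * (1 - \<rho>\<^sup>2)) + b\<^sup>2 / 2"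
    proof -
      have "(u + w * v) / (2 * w) = u / (2 * w) + v / 2" if "0 < w" for u v w :: real
        using that by (simp add: field_simps)
      from this[OF \<rho>] \<open>_ = a\<^sup>2 + (1 - \<rho>\<^sup>2) * b\<^sup>2\<close> show ?thesis by simp
    qed
    also have "a\<^sup>2 / (2 * (1 - \<rho>\<^sup>2)) = e\<^sup>2 / (2 * (\<sigma> * sqrt (1 - \<rho>\<^sup>2))\<^sup>2)"
      using \<rho> by (simp add: a_def power_divide power_mult_distrib mult.left_commute)
    also have "b\<^sup>2 / 2 = (y - \<mu>')\<^sup>2 / (2 * \<sigma>'\<^sup>2)"
      by (simp add: b_def power_divide mult.commute)
    finally have ex: "exp (- ((a + \<rho> * b)\<^sup>2 - 2 * \<rho> * (a + \<rho> * b) * b + b\<^sup>2) / (2 * (1 - \<rho>\<^sup>2)))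
        = exp (- (e - 0)\<^sup>2 / (2 * (\<sigma> * sqrt (1 - \<rho>\<^sup>2))\<^sup>2)) * exp (- (y - \<mu>')\<^sup>2 / (2 * \<sigma>'\<^sup>2))"
      unfolding exp_add[symmetric] minus_divide_left[symmetric] by simp
    have "sqrt (2 * pi * (\<sigma> * sqrt (1 - \<rho>\<^sup>2))\<^sup>2) * sqrt (2 * pi * \<sigma>'\<^sup>2)
        = sqrt (2 * pi) * sqrt (2 * pi) * (\<sigma> * sqrt (1 - \<rho>\<^sup>2)) * \<sigma>'"
      using pos \<open>0 < \<sigma>'\<close> by (simp add: real_sqrt_mult)
    also have "\<dots> = 2 * pi * \<sigma> * \<sigma>' * sqrt (1 - \<rho>\<^sup>2)" by simp
    finally have c: "2 * pi * \<sigma> * \<sigma>' * sqrt (1 - \<rho>\<^sup>2)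
        = sqrt (2 * pi * (\<sigma> * sqrt (1 - \<rho>\<^sup>2))\<^sup>2) * sqrt (2 * pi * \<sigma>'\<^sup>2)" ..
    have regroup: "1 / (u * v) * (e1 * e2) = 1 / u * e1 * (1 / v * e2)" for u v e1 e2 :: real by simp
    show ?thesis
      unfolding bivariate_normal_density_def normal_density_def prod.case x b_def[symmetric] ex c regroup ..
  qed
  have EY': "distributed M (lborel \<Otimes>\<^sub>M lborel) (\<lambda>\<omega>. (E \<omega>, Y \<omega>))
      (\<lambda>(e, y). ennreal (normal_density 0 (\<sigma> * sqrt (1 - \<rho>\<^sup>2)) e) * ennreal (normal_density \<mu>' \<sigma>' y))"
    using EY unfolding factor by (simp add: ennreal_mult'' normal_density_nonneg)
  note prod = distributed_product[OF EY']
  show "indep_rv borel E borel Y"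
    "distributed M lborel E (normal_density 0 (\<sigma> * sqrt (1 - \<rho>\<^sup>2)))"
    "distributed M lborel Y (normal_density \<mu>' \<sigma>')"
    using prod prob_space_normal_density[OF pos] prob_space_normal_density[OF \<open>0 < \<sigma>'\<close>] by simp_all
qed

end

section \<open>Mean and deviations of a normal sample\<close>

lemma sample_mean_cong: "(\<And>i. i \<in> {1..k} \<Longrightarrow> x i = y i) \<Longrightarrow> sample_mean k x = sample_mean k y"
  unfolding sample_mean_def by (intro arg_cong2[where f="(/)"] sum.cong) auto

lemma measurable_sample_mean:
  assumes "\<And>s. s \<in> {1..k} \<Longrightarrow> (\<lambda>x. y x s) \<in> borel_measurable Q"
  shows "(\<lambda>x. sample_mean k (y x)) \<in> borel_measurable Q"
proof -
  have "(\<lambda>x. \<Sum>s=1..k. y x s) \<in> borel_measurable Q"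
    using assms by (rule borel_measurable_sum)
  then show ?thesis unfolding sample_mean_def by simp
qed

lemma measurable_sample_mean_PiM:
  "{1..k} \<subseteq> I \<Longrightarrow> sample_mean k \<in> borel_measurable (PiM I (\<lambda>_. borel))"
  by (rule measurable_sample_mean) (auto intro: measurable_component_singleton)

lemma sample_mean_Suc:
  assumes "k \<ge> 1"
  shows "sample_mean (Suc k) x = sample_mean k x + (x (Suc k) - sample_mean k x) / (real k + 1)"
proof -
  have "(\<Sum>s=1..k. x s) = real k * sample_mean k x" using assms by (simp add: sample_mean_def)
  then have "sample_mean (Suc k) x = (real k * sample_mean k x + x (Suc k)) / (real k + 1)"
    by (simp add: sample_mean_def[of "Suc k"] add.commute)
  also have "\<dots> = sample_mean k x + (x (Suc k) - sample_mean k x) / (real k + 1)"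
    by (simp add: field_simps)
  finally show ?thesis .
qed

context prob_space begin

lemma sample_mean_normal:
  assumes "k \<ge> 1" and "indep_vars (\<lambda>_. borel) X {1..k}" and "0 < s"
    and "\<And>i. i \<in> {1..k} \<Longrightarrow> distributed M lborel (X i) (normal_density m s)"
  shows "distributed M lborel (\<lambda>\<omega>. sample_mean k (\<lambda>i. X i \<omega>)) (normal_density m (s / sqrt (real k)))"
proof -
  have "distributed M lborel (\<lambda>\<omega>. \<Sum>i\<in>{1..k}. 1 / real k * X i \<omega>)
      (normal_density (\<Sum>i\<in>{1..k}. 1 / real k * m) (sqrt (\<Sum>i\<in>{1..k}. (1 / real k * s)\<^sup>2)))"
    using assms by (intro normal_linear_combination[where j=1]) auto
  moreover have "(\<Sum>i\<in>{1..k}. 1 / real k * m) = m" using \<open>k \<ge> 1\<close> by simp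
  moreover have "sqrt (\<Sum>i\<in>{1..k}. (1 / real k * s)\<^sup>2) = s / sqrt (real k)"
  proof -
    have "(\<Sum>i\<in>{1..k}. (1 / real k * s)\<^sup>2) = s\<^sup>2 / real k"
      using \<open>k \<ge> 1\<close> by (simp add: power_divide power2_eq_square)
    then show ?thesis using \<open>0 < s\<close> by (simp add: real_sqrt_divide)
  qed
  ultimately show ?thesis by (simp add: sample_mean_def sum_divide_distrib)
qed

text \<open>By induction on the sample size. Let \<open>A\<close> and \<open>r\<close> be the mean and the deviations of the first
  \<open>k\<close> observations, and \<open>B\<close> the next observation; these three are mutually independent. The new
  mean \<open>C = A + (B - A) / (k + 1)\<close> is the weighted mean of \<open>A\<close> and \<open>B\<close> that is independent of
  \<open>D = B - A\<close>, and the pair \<open>(C, D)\<close> is independent of \<open>r\<close>. So \<open>C\<close> is independent of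
  \<open>(D, r)\<close>, which determines the new deviations.\<close>

lemma sample_mean_indep_deviations:
  fixes X :: "nat \<Rightarrow> 'a \<Rightarrow> real"
  assumes "k \<ge> 1" and "indep_vars (\<lambda>_. borel) X {1..k}" and "0 < s"
    and "\<And>i. i \<in> {1..k} \<Longrightarrow> distributed M lborel (X i) (normal_density m s)"
  shows "indep_rv borel (\<lambda>\<omega>. sample_mean k (\<lambda>i. X i \<omega>))
    (PiM {1..k} (\<lambda>_. borel)) (\<lambda>\<omega>. \<lambda>i\<in>{1..k}. X i \<omega> - sample_mean k (\<lambda>i. X i \<omega>))"
  using assms
proof (induction k rule: nat_induct_at_least)
  case base
  then have rv: "random_variable borel (X 1)" by (auto simp: indep_vars_def2)
  have mean: "(\<lambda>\<omega>. sample_mean 1 (\<lambda>i. X i \<omega>)) = X 1" by (simp add: sample_mean_def)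
  have residual: "(\<lambda>\<omega>. \<lambda>i\<in>{1..1}. X i \<omega> - sample_mean 1 (\<lambda>i. X i \<omega>)) = (\<lambda>\<omega>. \<lambda>i\<in>{1..1}. 0)"
    by (auto simp: sample_mean_def fun_eq_iff restrict_def)
  show ?case
    unfolding residual unfolding mean by (rule indep_rv_const[OF rv]) (simp add: space_PiM)
next
  case (Suc k)
  let ?P = "PiM {1..k} (\<lambda>_. borel :: real measure)"
  let ?A = "\<lambda>\<omega>. sample_mean k (\<lambda>i. X i \<omega>)" and ?B = "X (Suc k)"
  let ?R = "\<lambda>\<omega>. \<lambda>i\<in>{1..k}. X i \<omega> - sample_mean k (\<lambda>i. X i \<omega>)"
  have indk: "indep_vars (\<lambda>_. borel) X {1..k}"
    using Suc.prems(1) by (rule indep_vars_subset) auto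
  have IH: "indep_rv borel ?A ?P ?R"
    by (rule Suc.IH[OF indk Suc.prems(2)]) (use Suc.prems(3) in auto)
  have past_future: "indep_rv ?P (\<lambda>\<omega>. restrict (\<lambda>i. X i \<omega>) {1..k})
      (PiM {Suc k} (\<lambda>_. borel)) (\<lambda>\<omega>. restrict (\<lambda>i. X i \<omega>) {Suc k})"
    unfolding indep_var_iff_indep_rv[symmetric]
    using Suc.prems(1) by (rule indep_var_restrict) auto
  have sm: "sample_mean k (restrict x {1..k}) = sample_mean k x" for x
    by (rule sample_mean_cong) simp
  have residual_restrict: "(\<lambda>i\<in>{1..k}. restrict x {1..k} i - sample_mean k (restrict x {1..k}))
      = (\<lambda>i\<in>{1..k}. x i - sample_mean k x)" for x
    unfolding sm by (rule restrict_ext) simp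
  have next_meas: "(\<lambda>x. x (Suc k)) \<in> borel_measurable (PiM {Suc k} (\<lambda>_. borel :: real measure))"
    by (rule measurable_component_singleton) simp
  have residual_meas: "(\<lambda>x. \<lambda>i\<in>{1..k}. x i - sample_mean k x) \<in> measurable ?P ?P"
    by (intro measurable_restrict borel_measurable_diff measurable_component_singleton
        measurable_sample_mean_PiM) auto
  have "indep_rv (?P \<Otimes>\<^sub>M borel) (\<lambda>\<omega>. (?R \<omega>, ?A \<omega>)) borel ?B"
    using indep_rv_compose[OF past_future
        measurable_Pair[OF residual_meas measurable_sample_mean_PiM[OF order_refl]] next_meas]
    unfolding residual_restrict unfolding sm by simp
  from indep_rv_sym[OF indep_rv_assoc[OF indep_rv_sym[OF IH] this]]
  have AB_R: "indep_rv (borel \<Otimes>\<^sub>M borel) (\<lambda>\<omega>. (?A \<omega>, ?B \<omega>)) ?P ?R" .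
  have AB: "indep_rv borel ?A borel ?B"
    using indep_rv_compose[OF past_future measurable_sample_mean_PiM[OF order_refl] next_meas]
    unfolding sm by simp
  let ?C = "\<lambda>\<omega>. ?A \<omega> + (?B \<omega> - ?A \<omega>) / (real k + 1)" and ?D = "\<lambda>\<omega>. ?B \<omega> - ?A \<omega>"
  \<comment> \<open>the mean of \<open>k\<close> observations has variance \<open>s\<^sup>2 / k\<close>, which makes the weight \<open>1 / (k + 1)\<close>\<close>
  have weight: "(s / sqrt (real k))\<^sup>2 / ((s / sqrt (real k))\<^sup>2 + s\<^sup>2) = 1 / (real k + 1)"
  proof -
    have "s\<^sup>2 / real k + s\<^sup>2 = s\<^sup>2 / real k * (real k + 1)"
      using \<open>k \<ge> 1\<close> by (simp add: field_simps)
    then show ?thesis using \<open>k \<ge> 1\<close> \<open>0 < s\<close> by (simp add: power_divide)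
  qed
  have "distributed M lborel ?A (normal_density m (s / sqrt (real k)))"
    using Suc.hyps Suc.prems indk by (intro sample_mean_normal) auto
  then have "indep_rv borel (\<lambda>\<omega>. ?A \<omega> + 1 / (real k + 1) * (?B \<omega> - ?A \<omega>)) borel ?D"
    using indep_normal_weighted_mean_difference[OF AB _ \<open>0 < s\<close>, of "s / sqrt (real k)" m m] Suc.prems Suc.hyps
    unfolding weight by auto
  then have CD: "indep_rv borel ?C borel ?D" by simp
  have "(\<lambda>p. (fst p + (snd p - fst p) / (real k + 1), snd p - fst p))
      \<in> measurable (borel \<Otimes>\<^sub>M borel) (borel \<Otimes>\<^sub>M borel)"
    by measurable
  from indep_rv_compose[OF AB_R this measurable_ident]
  have "indep_rv (borel \<Otimes>\<^sub>M borel) (\<lambda>\<omega>. (?C \<omega>, ?D \<omega>)) ?P ?R" by simp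
  from indep_rv_assoc[OF CD this]
  have C_DR: "indep_rv borel ?C (borel \<Otimes>\<^sub>M ?P) (\<lambda>\<omega>. (?D \<omega>, ?R \<omega>))" .
  let ?g = "\<lambda>p. \<lambda>i\<in>{1..Suc k}. (if i = Suc k then fst p else snd p i) - fst p / (real k + 1)"
  have g: "?g \<in> measurable (borel \<Otimes>\<^sub>M ?P) (PiM {1..Suc k} (\<lambda>_. borel))"
  proof (rule measurable_restrict)
    fix i assume i: "i \<in> {1..Suc k}"
    have "(\<lambda>p. if i = Suc k then fst p else snd p i) \<in> borel_measurable (borel \<Otimes>\<^sub>M ?P)"
    proof (cases "i = Suc k")
      case False
      then have "(\<lambda>x. x i) \<in> borel_measurable ?P" using i by (intro measurable_component_singleton) auto
      from measurable_compose[OF measurable_snd this] show ?thesis using False by simp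
    qed simp
    then show "(\<lambda>p. (if i = Suc k then fst p else snd p i) - fst p / (real k + 1))
        \<in> borel_measurable (borel \<Otimes>\<^sub>M ?P)" by measurable
  qed
  have R_Suc: "?g (?D \<omega>, ?R \<omega>) = (\<lambda>i\<in>{1..Suc k}. X i \<omega> - sample_mean (Suc k) (\<lambda>i. X i \<omega>))" for \<omega>
    unfolding sample_mean_Suc[OF \<open>k \<ge> 1\<close>] by (auto simp: fun_eq_iff restrict_def)
  have C_Suc: "?C \<omega> = sample_mean (Suc k) (\<lambda>i. X i \<omega>)" for \<omega>
    unfolding sample_mean_Suc[OF \<open>k \<ge> 1\<close>] by simp
  show ?case
    using indep_rv_compose[OF C_DR measurable_ident g] unfolding R_Suc unfolding C_Suc id_apply .
qed

end

section \<open>Conditional law of a function of independent variables\<close>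

text \<open>If \<open>X\<close> and \<open>Y\<close> are independent, then given \<open>Y = y\<close> the variable \<open>\<phi> X Y\<close> has the law of
  \<open>\<phi> X y\<close>: by Fubini, its integral over an event determined by \<open>Y\<close> can be computed by averaging
  over \<open>X\<close> with \<open>Y\<close> held fixed. The conditioning field is any field inside that of \<open>Y\<close> for which
  the kernel is measurable.\<close>

lemma (in prob_space) has_cond_distr_freezing:
  assumes ind: "indep_rv S X T Y"
    and \<phi>: "(\<lambda>p. \<phi> (fst p) (snd p)) \<in> measurable (S \<Otimes>\<^sub>M T) N"
    and F: "subalgebra M F" and FY: "sets F \<subseteq> sets (vimage_algebra (space M) Y T)"
    and K: "K \<in> measurable F (prob_algebra N)"
    and frozen: "AE \<omega> in M. distr M N (\<lambda>\<omega>'. \<phi> (X \<omega>') (Y \<omega>)) = K \<omega>"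
  shows "has_cond_distr M F N (\<lambda>\<omega>. \<phi> (X \<omega>) (Y \<omega>)) K"
proof -
  note rv = indep_rvD(1,2)[OF ind]
  note law = indep_rvD(3)[OF ind]
  let ?W = "\<lambda>\<omega>. \<phi> (X \<omega>) (Y \<omega>)"
  have W: "random_variable N ?W"
    using measurable_compose[OF measurable_Pair[OF rv] \<phi>] by simp
  interpret SF: finite_measure_subalgebra M F by standard (rule F)
  interpret PX: prob_space "distr M S X" by (rule prob_space_distr) fact
  show ?thesis
    unfolding has_cond_distr_def
  proof (intro conjI ballI)
    fix A assume A: "A \<in> sets N"
    have KF: "(\<lambda>\<omega>. measure (K \<omega>) A) \<in> borel_measurable F"
      using K A by (intro measurable_compose[OF K measurable_measure_prob_algebra])
    then have KM: "(\<lambda>\<omega>. measure (K \<omega>) A) \<in> borel_measurable M"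
      by (rule measurable_from_subalg[OF F])
    have spF: "space F = space M" using F by (simp add: subalgebra_def)
    have Kprob: "prob_space (K \<omega>)" if "\<omega> \<in> space M" for \<omega>
      using measurable_space[OF K] that spF by (auto simp: space_prob_algebra)
    have int_ind: "integrable M (\<lambda>\<omega>. indicator A (?W \<omega>) :: real)"
      using W A by (intro integrable_const_bound[where B=1]) (auto simp: indicator_def)
    have int_K: "integrable M (\<lambda>\<omega>. measure (K \<omega>) A)"
      using KM Kprob prob_space.prob_le_1
      by (intro integrable_const_bound[where B=1]) (auto intro!: AE_I2)
    have cond: "(\<integral>\<omega>\<in>B. indicator A (?W \<omega>) \<partial>M) = (\<integral>\<omega>\<in>B. measure (K \<omega>) A \<partial>M)"
      if B: "B \<in> sets F" for B
    proof -
      obtain b where b: "b \<in> sets T" "B = Y -` b \<inter> space M"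
        using B FY sets_vimage_algebra2[of Y "space M" T] measurable_space[OF rv(2)] by auto
      have BM: "B \<in> sets M" using b rv by (auto intro: measurable_sets)
      let ?f = "\<lambda>p. indicator b (snd p) * indicator A (\<phi> (fst p) (snd p)) :: ennreal"
      have f: "?f \<in> borel_measurable (S \<Otimes>\<^sub>M T)"
      proof -
        have "(\<lambda>p. indicator A (\<phi> (fst p) (snd p)) :: ennreal) \<in> borel_measurable (S \<Otimes>\<^sub>M T)"
          using measurable_compose[OF \<phi> borel_measurable_indicator[OF A]] .
        moreover have "(\<lambda>p. indicator b (snd p) :: ennreal) \<in> borel_measurable (S \<Otimes>\<^sub>M T)"
          using measurable_compose[OF measurable_snd borel_measurable_indicator[OF b(1)]] .
        ultimately show ?thesis by (rule borel_measurable_times_ennreal[rotated])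
      qed
      have f': "?f \<in> borel_measurable (distr M S X \<Otimes>\<^sub>M distr M T Y)"
        using f by (simp cong: measurable_cong_sets sets_pair_measure_cong)
      have "(\<integral>\<^sup>+\<omega>. indicator B \<omega> * indicator A (?W \<omega>) \<partial>M) = (\<integral>\<^sup>+\<omega>. ?f (X \<omega>, Y \<omega>) \<partial>M)"
        using b(2) by (intro nn_integral_cong) (auto simp: indicator_def)
      also have "\<dots> = (\<integral>\<^sup>+p. ?f p \<partial>(distr M (S \<Otimes>\<^sub>M T) (\<lambda>\<omega>. (X \<omega>, Y \<omega>))))"
        using f measurable_Pair[OF rv] by (intro nn_integral_distr[symmetric]) simp_all
      also have "\<dots> = (\<integral>\<^sup>+y. \<integral>\<^sup>+x. ?f (x, y) \<partial>distr M S X \<partial>distr M T Y)"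
        unfolding law
        by (rule pair_sigma_finite.nn_integral_snd[symmetric, OF _ f'])
           (intro pair_sigma_finite.intro prob_space_imp_sigma_finite prob_space_distr rv)
      also have "\<dots> = (\<integral>\<^sup>+\<omega>. \<integral>\<^sup>+x. ?f (x, Y \<omega>) \<partial>distr M S X \<partial>M)"
      proof (rule nn_integral_distr[OF rv(2)])
        show "(\<lambda>y. \<integral>\<^sup>+x. ?f (x, y) \<partial>distr M S X) \<in> borel_measurable (distr M T Y)"
          using PX.borel_measurable_nn_integral[of "\<lambda>y x. ?f (x, y)" "distr M T Y"]
            measurable_compose[OF measurable_pair_swap', OF f']
          by (simp add: case_prod_beta)
      qed
      also have "\<dots> = (\<integral>\<^sup>+\<omega>. indicator B \<omega> * emeasure (distr M N (\<lambda>\<omega>'. \<phi> (X \<omega>') (Y \<omega>))) A \<partial>M)"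
      proof (rule nn_integral_cong)
        fix \<omega> assume \<omega>: "\<omega> \<in> space M"
        then have Y\<omega>: "Y \<omega> \<in> space T" using measurable_space[OF rv(2)] by auto
        have sec: "(\<lambda>x. \<phi> x (Y \<omega>)) \<in> measurable S N"
          using measurable_compose[OF measurable_Pair2'[OF Y\<omega>] \<phi>] by simp
        have "(\<integral>\<^sup>+x. ?f (x, Y \<omega>) \<partial>distr M S X)
            = indicator b (Y \<omega>) * (\<integral>\<^sup>+x. indicator A (\<phi> x (Y \<omega>)) \<partial>distr M S X)"
          using measurable_compose[OF sec borel_measurable_indicator[OF A]]
          unfolding fst_conv snd_conv by (intro nn_integral_cmult) simp
        also have "(\<integral>\<^sup>+x. indicator A (\<phi> x (Y \<omega>)) \<partial>distr M S X)
            = (\<integral>\<^sup>+\<omega>'. indicator A (\<phi> (X \<omega>') (Y \<omega>)) \<partial>M)"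
          using measurable_compose[OF sec borel_measurable_indicator[OF A]]
          by (intro nn_integral_distr[OF rv(1)]) simp
        also have "\<dots> = (\<integral>\<^sup>+z. indicator A z \<partial>distr M N (\<lambda>\<omega>'. \<phi> (X \<omega>') (Y \<omega>)))"
          using A measurable_compose[OF rv(1) sec] by (intro nn_integral_distr[symmetric]) simp_all
        also have "\<dots> = emeasure (distr M N (\<lambda>\<omega>'. \<phi> (X \<omega>') (Y \<omega>))) A"
          using A by simp
        finally show "(\<integral>\<^sup>+x. ?f (x, Y \<omega>) \<partial>distr M S X)
            = indicator B \<omega> * emeasure (distr M N (\<lambda>\<omega>'. \<phi> (X \<omega>') (Y \<omega>))) A"
          using b(2) \<omega> by (simp add: indicator_def)
      qed
      also have "\<dots> = (\<integral>\<^sup>+\<omega>. indicator B \<omega> * emeasure (K \<omega>) A \<partial>M)"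
        using frozen by (intro nn_integral_cong_AE) auto
      finally have nn: "(\<integral>\<^sup>+\<omega>. indicator B \<omega> * indicator A (?W \<omega>) \<partial>M)
          = (\<integral>\<^sup>+\<omega>. indicator B \<omega> * emeasure (K \<omega>) A \<partial>M)" .
      have "(\<integral>\<omega>\<in>B. indicator A (?W \<omega>) \<partial>M)
          = enn2real (\<integral>\<^sup>+\<omega>. ennreal (indicator B \<omega> * indicator A (?W \<omega>)) \<partial>M)"
        unfolding set_lebesgue_integral_def using BM int_ind
        by (subst integral_eq_nn_integral) auto
      also have "(\<integral>\<^sup>+\<omega>. ennreal (indicator B \<omega> * indicator A (?W \<omega>)) \<partial>M)
          = (\<integral>\<^sup>+\<omega>. indicator B \<omega> * indicator A (?W \<omega>) \<partial>M)"
        by (intro nn_integral_cong) (simp add: indicator_def)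
      also note nn
      also have "(\<integral>\<^sup>+\<omega>. indicator B \<omega> * emeasure (K \<omega>) A \<partial>M)
          = (\<integral>\<^sup>+\<omega>. ennreal (indicator B \<omega> * measure (K \<omega>) A) \<partial>M)"
      proof (rule nn_integral_cong)
        fix \<omega> assume "\<omega> \<in> space M"
        then interpret K: prob_space "K \<omega>" by (rule Kprob)
        show "indicator B \<omega> * emeasure (K \<omega>) A = ennreal (indicator B \<omega> * measure (K \<omega>) A)"
          by (simp add: K.emeasure_eq_measure indicator_def)
      qed
      also have "enn2real \<dots> = (\<integral>\<omega>\<in>B. measure (K \<omega>) A \<partial>M)"
        unfolding set_lebesgue_integral_def using BM KM
        by (subst integral_eq_nn_integral) auto
      finally show ?thesis .
    qed
    show "AE \<omega> in M. real_cond_exp M F (\<lambda>\<omega>. indicator A (?W \<omega>)) \<omega> = measure (K \<omega>) A"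
      by (rule SF.real_cond_exp_charact[OF cond int_ind int_K KF])
  qed (use F W K in auto)
qed

section \<open>Algebra of the estimator\<close>

text \<open>The part of the estimator that is due to the regression residuals \<open>e\<close>, where \<open>d\<close> is the
  distance between the online mean of the surrogates \<open>h\<close> and the pooled mean. The middle summand
  makes the decomposition below exact even when all online surrogates coincide: there the
  estimated slope is 0 instead of \<open>\<beta>\<close> plus noise.\<close>

definition mla_noise :: "nat \<Rightarrow> real \<Rightarrow> real \<Rightarrow> (nat \<Rightarrow> real) \<Rightarrow> (nat \<Rightarrow> real) \<Rightarrow> real" where
  "mla_noise n \<beta> d e h =
     (let S = \<Sum>s=1..n. (h s - sample_mean n h)\<^sup>2
      in sample_mean n e + (if S = 0 then \<beta> * d else 0)
           - d * ((\<Sum>s=1..n. e s * (h s - sample_mean n h)) / S))"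

lemma sum_deviations_zero:
  assumes "n \<ge> 1"
  shows "(\<Sum>s=1..n. h s - sample_mean n h) = 0"
  using assms by (simp add: sample_mean_def sum_subtractf)

lemma pooled_mean_offset:
  assumes "n \<ge> 1" "N \<ge> 1"
  shows "sample_mean n h - pooled_mean n N h u
    = real N / real (n + N) * (sample_mean n h - sample_mean N u)"
proof -
  have "pooled_mean n N h u = (real n * sample_mean n h + real N * sample_mean N u) / (real n + real N)"
    using assms by (simp add: pooled_mean_def sample_mean_def)
  then show ?thesis using assms by (simp add: field_simps)
qed

text \<open>The centred sums satisfy \<open>\<Sum> (r - rb) (h - hb) = \<beta> S + P\<close>, where \<open>S\<close> is the sum of squares of
  \<open>h\<close> and \<open>P\<close> is linear in \<open>e\<close>. The estimator thus subtracts \<open>\<beta> d\<close> from \<open>\<beta> (hb - \<mu>')\<close>, which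
  replaces the online mean \<open>hb\<close> by the pooled mean.\<close>

lemma mla_mean_decomposition:
  assumes "n \<ge> 2" "N \<ge> 1" and e: "\<And>s. s \<in> {1..n} \<Longrightarrow> e s = r s - (\<mu> + \<beta> * (h s - \<mu>'))"
  shows "mla_mean n N r h u = \<mu> + \<beta> * (pooled_mean n N h u - \<mu>')
    + mla_noise n \<beta> (sample_mean n h - pooled_mean n N h u) e h"
proof -
  define hb rb eb where "hb = sample_mean n h" and "rb = sample_mean n r" and "eb = sample_mean n e"
  define d where "d = hb - pooled_mean n N h u"
  define S where "S = (\<Sum>s=1..n. (h s - hb)\<^sup>2)"
  define P where "P = (\<Sum>s=1..n. e s * (h s - hb))"
  have n: "real n \<noteq> 0" "real n - 1 \<noteq> 0" using \<open>n \<ge> 2\<close> by auto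
  have dev: "(\<Sum>s=1..n. h s - hb) = 0"
    using sum_deviations_zero[of n h] \<open>n \<ge> 2\<close> by (simp add: hb_def)
  have r: "r s = e s + (\<mu> + \<beta> * (h s - \<mu>'))" if "s \<in> {1..n}" for s using e[OF that] by simp
  have "(\<Sum>s=1..n. r s) = (\<Sum>s=1..n. e s) + (real n * \<mu> + \<beta> * ((\<Sum>s=1..n. h s) - real n * \<mu>'))"
    by (subst sum.cong[OF refl r])
       (simp_all add: sum.distrib sum_subtractf sum_distrib_left[symmetric] algebra_simps)
  then have rb: "rb = \<mu> + \<beta> * (hb - \<mu>') + eb"
    using n by (simp add: rb_def hb_def eb_def sample_mean_def field_simps)
  have "(\<Sum>s=1..n. (r s - rb) * (h s - hb))
      = (\<Sum>s=1..n. \<beta> * (h s - hb)\<^sup>2 + e s * (h s - hb) - eb * (h s - hb))"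
    by (intro sum.cong refl) (simp add: r rb power2_eq_square algebra_simps)
  also have "\<dots> = \<beta> * S + P"
    using dev by (simp add: sum.distrib sum_subtractf[where g="\<lambda>s. eb * _ s"] sum_distrib_left[symmetric] S_def P_def)
  finally have cov: "(\<Sum>s=1..n. (r s - rb) * (h s - hb)) = \<beta> * S + P" .
  have "mla_lambda n N r h * (hb - sample_mean N u) = d * ((\<beta> * S + P) / S)"
    using n pooled_mean_offset[of n N h u] \<open>n \<ge> 2\<close> \<open>N \<ge> 1\<close> cov
    by (simp add: mla_lambda_def sample_cov_def sample_var_def d_def hb_def rb_def S_def)
  then have "mla_mean n N r h u = rb - d * ((\<beta> * S + P) / S)"
    by (simp add: mla_mean_def hb_def rb_def)
  also have "\<dots> = \<mu> + \<beta> * (pooled_mean n N h u - \<mu>') + (eb + (if S = 0 then \<beta> * d else 0) - d * (P / S))"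
    unfolding rb by (simp add: d_def add_divide_distrib algebra_simps)
  finally show ?thesis
    unfolding mla_noise_def Let_def d_def hb_def S_def P_def eb_def .
qed

text \<open>For fixed \<open>d\<close> the noise depends on the surrogates only through their deviations from any
  common centre; this is what separates it from the pooled mean.\<close>

lemma mla_noise_shift:
  assumes "n \<ge> 1"
  shows "mla_noise n \<beta> d e (\<lambda>s. h s - c) = mla_noise n \<beta> d e h"
proof -
  have "sample_mean n (\<lambda>s. h s - c) = sample_mean n h - c"
    using assms by (simp add: sample_mean_def sum_subtractf diff_divide_distrib)
  then show ?thesis unfolding mla_noise_def by simp
qed

lemma mla_noise_cong:
  assumes "\<And>s. s \<in> {1..n} \<Longrightarrow> e s = e' s" "\<And>s. s \<in> {1..n} \<Longrightarrow> h s = h' s"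
  shows "mla_noise n \<beta> d e h = mla_noise n \<beta> d e' h'"
proof -
  have means: "sample_mean n e = sample_mean n e'" "sample_mean n h = sample_mean n h'"
    using assms by (auto intro: sample_mean_cong)
  have "(\<Sum>s=1..n. (h s - sample_mean n h')\<^sup>2) = (\<Sum>s=1..n. (h' s - sample_mean n h')\<^sup>2)"
    "(\<Sum>s=1..n. e s * (h s - sample_mean n h')) = (\<Sum>s=1..n. e' s * (h' s - sample_mean n h'))"
    using assms by (auto intro!: sum.cong)
  then show ?thesis unfolding mla_noise_def means by simp
qed

lemma mla_noise_linear:
  assumes "(\<Sum>s=1..n. (h s - sample_mean n h)\<^sup>2) = S" "S \<noteq> 0"
  shows "mla_noise n \<beta> d e h = (\<Sum>s=1..n. (1 / real n - d * (h s - sample_mean n h) / S) * e s)"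
proof -
  have summand: "(1 / k - d * x / S) * a = a / k - d / S * (a * x)" for k x a :: real
    by (cases "k = 0") (use assms(2) in \<open>simp_all add: field_simps\<close>)
  have "(\<Sum>s=1..n. (1 / real n - d * (h s - sample_mean n h) / S) * e s)
     = (\<Sum>s=1..n. e s / real n - d / S * (e s * (h s - sample_mean n h)))"
    by (intro sum.cong refl summand)
  then show ?thesis
    using assms by (simp add: mla_noise_def sum_subtractf sum_distrib_left[symmetric]
        sum_divide_distrib[symmetric] sample_mean_def)
qed

text \<open>The cross term vanishes because deviations from the mean sum to 0. With \<open>d\<close> the distance to
  the pooled mean, the right-hand side is \<open>Z / n\<close>.\<close>

lemma mla_noise_weights_square_sum:
  assumes "(\<Sum>s=1..n. (h s - sample_mean n h)\<^sup>2) = S" "S \<noteq> 0" "n \<ge> 1"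
  shows "(\<Sum>s=1..n. (1 / real n - d * (h s - sample_mean n h) / S)\<^sup>2)
    = 1 / real n * (1 + real n * d\<^sup>2 / S)"
proof -
  have "(\<Sum>s=1..n. (1 / real n - d * (h s - sample_mean n h) / S)\<^sup>2)
      = (\<Sum>s=1..n. 1 / (real n)\<^sup>2 - 2 * d / (real n * S) * (h s - sample_mean n h)
            + d\<^sup>2 / S\<^sup>2 * (h s - sample_mean n h)\<^sup>2)"
    by (intro sum.cong refl) (simp add: power2_diff power_divide power_mult_distrib)
  also have "\<dots> = real n / (real n)\<^sup>2 - 2 * d / (real n * S) * (\<Sum>s=1..n. h s - sample_mean n h)
            + d\<^sup>2 / S\<^sup>2 * S"
    unfolding assms(1)[symmetric] sum_distrib_left by (simp add: sum.distrib sum_subtractf)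
  also have "\<dots> = 1 / real n * (1 + real n * d\<^sup>2 / S)"
    unfolding sum_deviations_zero[OF assms(3)] using assms(2,3) by (simp add: field_simps power2_eq_square)
  finally show ?thesis .
qed

lemma mla_Z_ge_1: "mla_Z n N h u \<ge> 1"
  unfolding mla_Z_def by (simp add: sum_nonneg)

section \<open>Measurability and normal laws\<close>

lemma measurable_mla_noise:
  assumes [measurable]: "d \<in> borel_measurable Q"
    and e: "\<And>s. s \<in> {1..n} \<Longrightarrow> (\<lambda>x. e x s) \<in> borel_measurable Q"
    and h: "\<And>s. s \<in> {1..n} \<Longrightarrow> (\<lambda>x. h x s) \<in> borel_measurable Q"
  shows "(\<lambda>x. mla_noise n \<beta> (d x) (e x) (h x)) \<in> borel_measurable Q"
proof -
  note [measurable] = measurable_sample_mean[OF e] measurable_sample_mean[OF h]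
  have [measurable]: "(\<lambda>x. \<Sum>s=1..n. (h x s - sample_mean n (h x))\<^sup>2) \<in> borel_measurable Q"
    by (intro borel_measurable_sum borel_measurable_power borel_measurable_diff measurable_sample_mean h)
  have [measurable]: "(\<lambda>x. \<Sum>s=1..n. e x s * (h x s - sample_mean n (h x))) \<in> borel_measurable Q"
    by (intro borel_measurable_sum borel_measurable_times borel_measurable_diff measurable_sample_mean h e)
  show ?thesis unfolding mla_noise_def Let_def by measurable
qed

lemma measurable_pooled_mean:
  assumes h: "\<And>s. s \<in> {1..n} \<Longrightarrow> (\<lambda>x. h x s) \<in> borel_measurable Q"
    and u: "\<And>s. s \<in> {1..N} \<Longrightarrow> (\<lambda>x. u x s) \<in> borel_measurable Q"
  shows "(\<lambda>x. pooled_mean n N (h x) (u x)) \<in> borel_measurable Q"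
  unfolding pooled_mean_def
  by (intro borel_measurable_divide borel_measurable_add borel_measurable_sum borel_measurable_const h u)

lemma measurable_mla_Z:
  assumes h: "\<And>s. s \<in> {1..n} \<Longrightarrow> (\<lambda>x. h x s) \<in> borel_measurable Q"
    and u: "\<And>s. s \<in> {1..N} \<Longrightarrow> (\<lambda>x. u x s) \<in> borel_measurable Q"
  shows "(\<lambda>x. mla_Z n N (h x) (u x)) \<in> borel_measurable Q"
  unfolding mla_Z_def
  by (intro borel_measurable_divide borel_measurable_add borel_measurable_sum borel_measurable_const
      borel_measurable_times borel_measurable_power borel_measurable_diff
      measurable_sample_mean measurable_pooled_mean h u)

lemma prob_space_normal_law: "v > 0 \<Longrightarrow> prob_space (normal_law m v)"
  unfolding normal_law_def using prob_space_normal_density[of "sqrt v" m] by simp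

lemma measurable_normal_law:
  assumes [measurable]: "v \<in> borel_measurable Q" and pos: "\<And>x. x \<in> space Q \<Longrightarrow> v x > 0"
  shows "(\<lambda>x. normal_law m (v x)) \<in> measurable Q (prob_algebra borel)"
proof (rule measurable_prob_algebraI)
  show "prob_space (normal_law m (v x))" if "x \<in> space Q" for x
    using prob_space_normal_law pos[OF that] .
  show "(\<lambda>x. normal_law m (v x)) \<in> measurable Q (subprob_algebra borel)"
  proof (rule measurable_subprob_algebra)
    fix x assume x: "x \<in> space Q"
    show "subprob_space (normal_law m (v x))"
      using prob_space_normal_law[OF pos[OF x]] by (rule prob_space_imp_subprob_space)
    show "sets (normal_law m (v x)) = sets borel" by (simp add: normal_law_def)
  next
    fix A :: "real set" assume A[measurable]: "A \<in> sets borel"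
    have "(\<lambda>x. \<integral>\<^sup>+y. ennreal (normal_density m (sqrt (v x)) y) * indicator A y \<partial>lborel)
        \<in> borel_measurable Q"
      unfolding normal_density_def by measurable
    moreover have "emeasure (normal_law m (v x)) A
        = (\<integral>\<^sup>+y. ennreal (normal_density m (sqrt (v x)) y) * indicator A y \<partial>lborel)"
      if "x \<in> space Q" for x
      using pos[OF that] A by (simp add: normal_law_def emeasure_density)
    ultimately show "(\<lambda>x. emeasure (normal_law m (v x)) A) \<in> borel_measurable Q"
      by (simp cong: measurable_cong)
  qed
qed

lemma (in prob_space) distr_eq_normal_law:
  assumes X: "distributed M lborel X (normal_density m s)" and "s > 0"
  shows "distr M borel X = normal_law m (s\<^sup>2)"
proof -
  have "distr M borel X = distr M lborel X" by (rule distr_cong) simp_all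
  then show ?thesis
    using \<open>s > 0\<close> by (simp add: distributed_distr_eq_density[OF X] normal_law_def)
qed

section \<open>The decomposition of the estimator\<close>

lemma pooled_mean_eq_sample_mean:
  "pooled_mean n N h u = sample_mean (n + N) (\<lambda>i. if i \<le> n then h i else u (i - n))"
proof -
  let ?x = "\<lambda>i. if i \<le> n then h i else u (i - n)"
  have "(\<Sum>i=1..n + N. ?x i) = (\<Sum>i=1..n. ?x i) + (\<Sum>i=n + 1..n + N. ?x i)"
    by (rule sum.ub_add_nat) simp
  also have "(\<Sum>i=1..n. ?x i) = (\<Sum>i=1..n. h i)" by (intro sum.cong) auto
  also have "(\<Sum>i=n + 1..n + N. ?x i) = (\<Sum>i=1 + n..N + n. ?x i)" by (simp add: add.commute)
  also have "\<dots> = (\<Sum>i=1..N. ?x (i + n))" by (rule sum.shift_bounds_cl_nat_ivl)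
  also have "\<dots> = (\<Sum>i=1..N. u i)" by (intro sum.cong) auto
  finally show ?thesis by (simp add: pooled_mean_def sample_mean_def)
qed

context prob_space begin

text \<open>Residuals and surrogates as one family: index \<open>(s, True)\<close> is the residual of the \<open>s\<close>-th online
  pair, \<open>(s, False)\<close> the \<open>s\<close>-th surrogate, with the offline surrogates numbered after the online
  ones. The block lemma is used twice, with the online pairs as blocks and then with the online and
  the offline observations as the two blocks.\<close>

lemma indep_vars_regression_family:
  fixes R H U :: "nat \<Rightarrow> 'a \<Rightarrow> real" and f :: "real \<times> real \<Rightarrow> real" and n N :: nat
  assumes online: "indep_vars (\<lambda>_. borel \<Otimes>\<^sub>M borel) (\<lambda>s \<omega>. (R s \<omega>, H s \<omega>)) {1..}"
    and f: "f \<in> borel_measurable (borel \<Otimes>\<^sub>M borel)"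
    and residual: "\<And>s. s \<ge> 1 \<Longrightarrow> indep_rv borel (\<lambda>\<omega>. f (R s \<omega>, H s \<omega>)) borel (H s)"
    and offline: "indep_vars (\<lambda>_. borel) U {1..N}"
    and blocks: "indep_set
         (sets (vimage_algebra (space M) (\<lambda>\<omega>. \<lambda>s\<in>{1..}. (R s \<omega>, H s \<omega>))
                  (\<Pi>\<^sub>M s\<in>{1..}. borel \<Otimes>\<^sub>M borel)))
         (sets (vimage_algebra (space M) (\<lambda>\<omega>. \<lambda>s\<in>{1..N}. U s \<omega>) (\<Pi>\<^sub>M s\<in>{1..N}. borel)))"
  defines "V \<equiv> \<lambda>(s, c) \<omega>. if c then f (R s \<omega>, H s \<omega>) else if s \<le> n then H s \<omega> else U (s - n) \<omega>"
  shows "indep_vars (\<lambda>_. borel) V ({1..n} \<times> {True} \<union> {1..n + N} \<times> {False})"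
proof -
  define W where "W = (\<lambda>(s, c) \<omega>. if c then f (R s \<omega>, H s \<omega>) else H s \<omega>)"
  define G where "G = (\<lambda>s. {(\<lambda>\<omega>. (R s \<omega>, H s \<omega>)) -` A \<inter> space M | A. A \<in> sets (borel \<Otimes>\<^sub>M borel)})"
  have W_eq: "W (s, c) = (\<lambda>\<omega>. (if c then f else snd) (R s \<omega>, H s \<omega>))" for s c
    by (simp add: W_def)
  have proj: "(if c then f else snd) \<in> borel_measurable (borel \<Otimes>\<^sub>M borel)" for c
    using f by simp
  have "indep_vars (\<lambda>_. borel) W (\<Union>s\<in>{1..}. {(s, True), (s, False)})"
  proof (rule indep_vars_UN_disjoint[where G=G])
    show "indep_sets G {1..}" using online by (simp add: indep_vars_def2 G_def)
    show "Int_stable (G s)" if "s \<in> {1..}" for s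
    proof (rule Int_stableI)
      fix a b assume "a \<in> G s" "b \<in> G s"
      then obtain A B where "A \<in> sets (borel \<Otimes>\<^sub>M borel)" "B \<in> sets (borel \<Otimes>\<^sub>M borel)"
        "a = (\<lambda>\<omega>. (R s \<omega>, H s \<omega>)) -` A \<inter> space M" "b = (\<lambda>\<omega>. (R s \<omega>, H s \<omega>)) -` B \<inter> space M"
        by (auto simp: G_def)
      then show "a \<inter> b \<in> G s" unfolding G_def by (intro CollectI exI[of _ "A \<inter> B"]) auto
    qed
    show "disjoint_family_on (\<lambda>s. {(s, True), (s, False)}) {1..}"
      by (auto simp: disjoint_family_on_def)
    show "indep_vars (\<lambda>_. borel) W {(s, True), (s, False)}" if "s \<in> {1..}" for s :: nat
      using residual[of s] that
      by (intro indep_vars_doubleton) (auto simp: indep_var_iff_indep_rv W_def)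
    show "W j -` A \<inter> space M \<in> G s"
      if "s \<in> {1..}" "j \<in> {(s, True), (s, False)}" "A \<in> sets borel" for s j A
    proof -
      from that(2) obtain c where j: "j = (s, c)" by blast
      have "(if c then f else snd) -` A \<in> sets (borel \<Otimes>\<^sub>M borel)"
        using measurable_sets[OF proj that(3)] by (simp add: space_pair_measure)
      moreover have "W j -` A \<inter> space M
          = (\<lambda>\<omega>. (R s \<omega>, H s \<omega>)) -` ((if c then f else snd) -` A) \<inter> space M"
        unfolding j W_eq by auto
      ultimately show ?thesis unfolding G_def by blast
    qed
  qed
  then have W: "indep_vars (\<lambda>_. borel) W ({1..n} \<times> UNIV)"
    by (rule indep_vars_subset) auto
  let ?on = "vimage_algebra (space M) (\<lambda>\<omega>. \<lambda>s\<in>{1..}. (R s \<omega>, H s \<omega>)) (\<Pi>\<^sub>M s\<in>{1..}. borel \<Otimes>\<^sub>M borel)"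
  let ?off = "vimage_algebra (space M) (\<lambda>\<omega>. \<lambda>s\<in>{1..N}. U s \<omega>) (\<Pi>\<^sub>M s\<in>{1..N}. borel)"
  let ?J = "\<lambda>b. if b then {1..n} \<times> UNIV else {n + 1..n + N} \<times> {False}"
  have on_meas: "V (s, c) \<in> borel_measurable ?on" if "s \<in> {1..n}" for s c
  proof -
    have "(\<lambda>\<omega>. \<lambda>s\<in>{1..}. (R s \<omega>, H s \<omega>)) \<in> measurable ?on (\<Pi>\<^sub>M s\<in>{1..}. borel \<Otimes>\<^sub>M borel)"
      by (rule measurable_vimage_algebra1) (auto simp: space_PiM space_pair_measure)
    from measurable_compose[OF this measurable_component_singleton[of s]]
    have pair: "(\<lambda>\<omega>. (R s \<omega>, H s \<omega>)) \<in> measurable ?on (borel \<Otimes>\<^sub>M borel)" using that by simp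
    have V_eq: "V (s, c) = (\<lambda>\<omega>. (if c then f else snd) (R s \<omega>, H s \<omega>))"
      using that by (auto simp: V_def fun_eq_iff)
    show ?thesis unfolding V_eq using measurable_compose[OF pair proj[of c]] .
  qed
  have off_meas: "V (s, False) \<in> borel_measurable ?off" if "s \<in> {n + 1..n + N}" for s
  proof -
    have restr: "(\<lambda>\<omega>. \<lambda>s\<in>{1..N}. U s \<omega>) \<in> measurable ?off (\<Pi>\<^sub>M s\<in>{1..N}. borel)"
      by (rule measurable_vimage_algebra1) (auto simp: space_PiM)
    have sN: "s - n \<in> {1..N}" using that by auto
    from measurable_compose[OF restr measurable_component_singleton[OF sN]]
    have "U (s - n) \<in> borel_measurable ?off" using sN by simp
    then show ?thesis using that by (auto simp: V_def)
  qed
  have "indep_vars (\<lambda>_. borel) V (\<Union>b\<in>UNIV. ?J b)"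
  proof (rule indep_vars_UN_disjoint)
    show "indep_sets (case_bool (sets ?on) (sets ?off)) UNIV"
      using blocks by (simp add: indep_set_def)
    show "Int_stable (case b of True \<Rightarrow> sets ?on | False \<Rightarrow> sets ?off)" for b
      by (cases b) (simp_all add: sets.Int_stable)
    show "disjoint_family_on ?J UNIV" by (auto simp: disjoint_family_on_def)
    show "V j -` A \<inter> space M \<in> (case b of True \<Rightarrow> sets ?on | False \<Rightarrow> sets ?off)"
      if "j \<in> ?J b" "A \<in> sets borel" for b j A
    proof (cases b)
      case True
      with that(1) obtain s c where "j = (s, c)" "s \<in> {1..n}" by auto
      then show ?thesis using measurable_sets[OF on_meas that(2)] True by auto
    next
      case False
      with that(1) obtain s where "j = (s, False)" "s \<in> {n + 1..n + N}" by auto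
      then show ?thesis using measurable_sets[OF off_meas that(2)] False by auto
    qed
    show "indep_vars (\<lambda>_. borel) V (?J b)" for b
    proof (cases b)
      case True
      have "indep_vars (\<lambda>_. borel) V ({1..n} \<times> UNIV) \<longleftrightarrow> indep_vars (\<lambda>_. borel) W ({1..n} \<times> UNIV)"
        by (rule indep_vars_cong) (auto simp: V_def W_def fun_eq_iff)
      then show ?thesis using W True by simp
    next
      case False
      have J: "{n + 1..n + N} \<times> {False} = (\<lambda>s. (s + n, False)) ` {1..N}"
      proof (intro equalityI subsetI)
        fix p assume "p \<in> {n + 1..n + N} \<times> {False}"
        then show "p \<in> (\<lambda>s. (s + n, False)) ` {1..N}"
          by (intro image_eqI[of _ _ "fst p - n"]) auto
      qed auto
      have "indep_vars (\<lambda>_. borel) (\<lambda>s. V (s + n, False)) {1..N} \<longleftrightarrow> indep_vars (\<lambda>_. borel) U {1..N}"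
        by (rule indep_vars_cong) (auto simp: V_def fun_eq_iff)
      then show ?thesis
        unfolding if_not_P[OF False] J using offline
        by (subst indep_vars_reindex) (auto simp: inj_on_def)
    qed
  qed
  moreover have "(\<Union>b\<in>UNIV. ?J b) = {n + 1..n + N} \<times> {False} \<union> {1..n} \<times> UNIV"
    by (simp add: UNIV_bool)
  ultimately have "indep_vars (\<lambda>_. borel) V ({n + 1..n + N} \<times> {False} \<union> {1..n} \<times> UNIV)"
    by (simp only:)
  then show ?thesis by (rule indep_vars_subset) auto
qed

lemma distributed_lborel_AE_neq:
  assumes "distributed M lborel X f"
  shows "AE \<omega> in M. X \<omega> \<noteq> (c :: real)"
proof -
  have "Measurable.pred lborel (\<lambda>x :: real. x \<noteq> c)" by measurable
  from distributed_AE2[OF assms this] show ?thesis using AE_lborel_singleton[of c] by auto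
qed

end

text \<open>Here \<open>h\<close> and \<open>d\<close> are constants: this is the law of the noise once the surrogates are frozen.\<close>

lemma (in prob_space) distr_mla_noise:
  assumes "n \<ge> 1" and E: "indep_vars (\<lambda>_. borel) E {1..n}" and "\<tau> > 0"
    and normal: "\<And>s. s \<in> {1..n} \<Longrightarrow> distributed M lborel (E s) (normal_density 0 \<tau>)"
    and S: "(\<Sum>s=1..n. (h s - sample_mean n h)\<^sup>2) = S" "S \<noteq> 0"
  shows "distr M borel (\<lambda>\<omega>. mla_noise n \<beta> d (\<lambda>s. E s \<omega>) h)
    = normal_law 0 (1 / real n * (1 + real n * d\<^sup>2 / S) * \<tau>\<^sup>2)"
proof -
  define w where "w = (\<lambda>s. 1 / real n - d * (h s - sample_mean n h) / S)"
  have "S > 0" using S sum_nonneg[of "{1..n}" "\<lambda>s. (h s - sample_mean n h)\<^sup>2"] by auto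
  have w2: "(\<Sum>s=1..n. (w s)\<^sup>2) = 1 / real n * (1 + real n * d\<^sup>2 / S)"
    unfolding w_def by (rule mla_noise_weights_square_sum[OF S \<open>n \<ge> 1\<close>])
  also have "\<dots> > 0"
    using \<open>S > 0\<close> \<open>n \<ge> 1\<close> by (intro mult_pos_pos add_pos_nonneg) auto
  finally have w2_pos: "(\<Sum>s=1..n. (w s)\<^sup>2) > 0" .
  then obtain j where j: "j \<in> {1..n}" "w j \<noteq> 0"
    by (metis (no_types, lifting) less_irrefl sum.neutral zero_power2)
  have w2\<tau>: "(\<Sum>s=1..n. (w s * \<tau>)\<^sup>2) = (\<Sum>s=1..n. (w s)\<^sup>2) * \<tau>\<^sup>2"
    by (simp add: power_mult_distrib sum_distrib_right)
  have "distributed M lborel (\<lambda>\<omega>. \<Sum>s\<in>{1..n}. w s * E s \<omega>)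
      (normal_density (\<Sum>s\<in>{1..n}. w s * 0) (sqrt (\<Sum>s\<in>{1..n}. (w s * \<tau>)\<^sup>2)))"
    using E normal \<open>\<tau> > 0\<close> j by (intro normal_linear_combination) auto
  then have lin: "distributed M lborel (\<lambda>\<omega>. \<Sum>s\<in>{1..n}. w s * E s \<omega>)
      (normal_density 0 (sqrt (\<Sum>s\<in>{1..n}. (w s * \<tau>)\<^sup>2)))"
    by simp
  have pos: "(\<Sum>s\<in>{1..n}. (w s * \<tau>)\<^sup>2) > 0" unfolding w2\<tau> using w2_pos \<open>\<tau> > 0\<close> by simp
  have "(\<lambda>\<omega>. mla_noise n \<beta> d (\<lambda>s. E s \<omega>) h) = (\<lambda>\<omega>. \<Sum>s\<in>{1..n}. w s * E s \<omega>)"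
    unfolding mla_noise_linear[OF S] w_def ..
  then show ?thesis
    using distr_eq_normal_law[OF lin] pos unfolding w2[symmetric] w2\<tau>[symmetric] by simp
qed

theorem proposition2:
  fixes M :: "'a measure"
    and R H U :: "nat \<Rightarrow> 'a \<Rightarrow> real"
    and \<mu> \<mu>' \<sigma> \<sigma>' \<rho> :: real
    and n N :: nat
  assumes "prob_space M"
    and "\<sigma> > 0" and "\<sigma>' > 0" and "-1 < \<rho>" and "\<rho> < 1"
    and "N \<ge> 1" and "n \<ge> 2"
    and online_indep:
      "prob_space.indep_vars M (\<lambda>_. borel \<Otimes>\<^sub>M borel) (\<lambda>s \<omega>. (R s \<omega>, H s \<omega>)) {1..}"
    and online_law:
      "\<And>s. s \<ge> 1 \<Longrightarrow> distributed M (lborel \<Otimes>\<^sub>M lborel) (\<lambda>\<omega>. (R s \<omega>, H s \<omega>))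
                       (bivariate_normal_density \<mu> \<mu>' \<sigma> \<sigma>' \<rho>)"
    and offline_indep: "prob_space.indep_vars M (\<lambda>_. borel) U {1..N}"
    and offline_law:
      "\<And>s. s \<in> {1..N} \<Longrightarrow> distributed M lborel (U s) (normal_density \<mu>' \<sigma>')"
    and online_offline_indep:
      "prob_space.indep_set M
         (sets (vimage_algebra (space M) (\<lambda>\<omega>. \<lambda>s\<in>{1..}. (R s \<omega>, H s \<omega>))
                  (\<Pi>\<^sub>M s\<in>{1..}. borel \<Otimes>\<^sub>M borel)))
         (sets (vimage_algebra (space M) (\<lambda>\<omega>. \<lambda>s\<in>{1..N}. U s \<omega>) (\<Pi>\<^sub>M s\<in>{1..N}. borel)))"
  defines "F \<equiv> surrogate_field M n N H U"
    and "Z \<equiv> (\<lambda>\<omega>. mla_Z n N (\<lambda>s. H s \<omega>) (\<lambda>s. U s \<omega>))"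
  shows "Z \<in> borel_measurable F \<and>
    (\<exists>S1 S2 :: 'a \<Rightarrow> real.
      (\<forall>\<omega>\<in>space M. mla_mean n N (\<lambda>s. R s \<omega>) (\<lambda>s. H s \<omega>) (\<lambda>s. U s \<omega>) = \<mu> + S1 \<omega> + S2 \<omega>) \<and>
      prob_space.indep_var M borel S1 borel S2 \<and>
      S1 \<in> borel_measurable F \<and>
      distr M borel S1 = normal_law 0 (1 / real (n + N) * \<rho>\<^sup>2 * \<sigma>\<^sup>2) \<and>
      has_cond_distr M F borel S2
        (\<lambda>\<omega>. normal_law 0 (1 / real n * Z \<omega> * (1 - \<rho>\<^sup>2) * \<sigma>\<^sup>2)))"
proof -
  interpret prob_space M by fact
  define \<beta> \<tau> m where "\<beta> = \<rho> * \<sigma> / \<sigma>'" and "\<tau> = \<sigma> * sqrt (1 - \<rho>\<^sup>2)" and "m = n + N"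
  have \<rho>: "0 < 1 - \<rho>\<^sup>2" using \<open>-1 < \<rho>\<close> \<open>\<rho> < 1\<close> by (simp add: abs_square_less_1 abs_if)
  have "\<tau> > 0" using \<rho> \<open>\<sigma> > 0\<close> by (simp add: \<tau>_def)
  have \<tau>2: "\<tau>\<^sup>2 = (1 - \<rho>\<^sup>2) * \<sigma>\<^sup>2" using \<rho> by (simp add: \<tau>_def power_mult_distrib)
  have "m \<ge> 1" "n \<ge> 1" using \<open>n \<ge> 2\<close> by (simp_all add: m_def)

  \<comment> \<open>\<open>E\<close> are the regression residuals; \<open>X\<close> lists the online surrogates, then the offline ones\<close>
  define f where "f = (\<lambda>p :: real \<times> real. fst p - (\<mu> + \<beta> * (snd p - \<mu>')))"
  define E where "E = (\<lambda>s \<omega>. f (R s \<omega>, H s \<omega>))"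
  define X where "X = (\<lambda>i \<omega>. if i \<le> n then H i \<omega> else U (i - n) \<omega>)"
  have f_meas: "f \<in> borel_measurable (borel \<Otimes>\<^sub>M borel)" unfolding f_def by measurable
  have regression: "indep_rv borel (E s) borel (H s)"
      "distributed M lborel (E s) (normal_density 0 \<tau>)"
      "distributed M lborel (H s) (normal_density \<mu>' \<sigma>')" if "s \<ge> 1" for s
    using bivariate_normal_regression[OF online_law[OF that] \<open>\<sigma> > 0\<close> \<open>\<sigma>' > 0\<close> \<open>-1 < \<rho>\<close> \<open>\<rho> < 1\<close>]
    by (simp_all add: E_def f_def \<beta>_def \<tau>_def)
  have X_normal: "distributed M lborel (X i) (normal_density \<mu>' \<sigma>')" if "i \<in> {1..m}" for i
  proof (cases "i \<le> n")
    case True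
    then show ?thesis using regression(3)[of i] that by (simp add: X_def)
  next
    case False
    then have "i - n \<in> {1..N}" using that by (auto simp: m_def)
    then show ?thesis using offline_law False by (simp add: X_def)
  qed

  define V where "V = (\<lambda>(s, c) \<omega>. if c then f (R s \<omega>, H s \<omega>) else if s \<le> n then H s \<omega> else U (s - n) \<omega>)"
  have V: "indep_vars (\<lambda>_. borel) V ({1..n} \<times> {True} \<union> {1..m} \<times> {False})"
    unfolding V_def m_def
    using online_indep f_meas regression(1)[unfolded E_def] offline_indep online_offline_indep
    by (rule indep_vars_regression_family)
  have V_eq: "V (s, True) = E s" "V (s, False) = X s" for s
    by (simp_all add: V_def E_def X_def)
  have E_indep: "indep_vars (\<lambda>_. borel) E {1..n}"
  proof -
    have "indep_vars (\<lambda>_. borel) V ((\<lambda>s. (s, True)) ` {1..n})"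
      using V by (rule indep_vars_subset) auto
    then show ?thesis by (simp add: indep_vars_reindex inj_on_def V_eq)
  qed
  have X_indep: "indep_vars (\<lambda>_. borel) X {1..m}"
  proof -
    have "indep_vars (\<lambda>_. borel) V ((\<lambda>s. (s, False)) ` {1..m})"
      using V by (rule indep_vars_subset) auto
    then show ?thesis by (simp add: indep_vars_reindex inj_on_def V_eq)
  qed
  let ?PE = "PiM {1..n} (\<lambda>_. borel :: real measure)" and ?PX = "PiM {1..m} (\<lambda>_. borel :: real measure)"
  define Ev Xv where "Ev = (\<lambda>\<omega>. \<lambda>s\<in>{1..n}. E s \<omega>)" and "Xv = (\<lambda>\<omega>. \<lambda>i\<in>{1..m}. X i \<omega>)"
  have Ev_Xv: "indep_rv ?PE Ev ?PX Xv"
  proof -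
    have "indep_rv (PiM ({1..n} \<times> {True}) (\<lambda>_. borel)) (\<lambda>\<omega>. \<lambda>p\<in>{1..n} \<times> {True}. V p \<omega>)
        (PiM ({1..m} \<times> {False}) (\<lambda>_. borel)) (\<lambda>\<omega>. \<lambda>p\<in>{1..m} \<times> {False}. V p \<omega>)"
      unfolding indep_var_iff_indep_rv[symmetric] using V by (rule indep_var_restrict) auto
    from indep_rv_compose[OF this, of "\<lambda>x. \<lambda>s\<in>{1..n}. x (s, True)" ?PE "\<lambda>x. \<lambda>i\<in>{1..m}. x (i, False)" ?PX]
    have "indep_rv ?PE (\<lambda>\<omega>. \<lambda>s\<in>{1..n}. (\<lambda>p\<in>{1..n} \<times> {True}. V p \<omega>) (s, True))
        ?PX (\<lambda>\<omega>. \<lambda>i\<in>{1..m}. (\<lambda>p\<in>{1..m} \<times> {False}. V p \<omega>) (i, False))"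
      by (auto intro!: measurable_restrict measurable_component_singleton)
    moreover have "(\<lambda>s\<in>{1..n}. (\<lambda>p\<in>{1..n} \<times> {True}. V p \<omega>) (s, True)) = Ev \<omega>"
      "(\<lambda>i\<in>{1..m}. (\<lambda>p\<in>{1..m} \<times> {False}. V p \<omega>) (i, False)) = Xv \<omega>" for \<omega>
      unfolding Ev_def Xv_def by (auto intro!: restrict_ext simp: V_eq)
    ultimately show ?thesis by (simp only: eta_contract_eq)
  qed

  define xb where "xb = (\<lambda>\<omega>. sample_mean m (\<lambda>i. X i \<omega>))"
  define Rv where "Rv = (\<lambda>\<omega>. \<lambda>i\<in>{1..m}. X i \<omega> - xb \<omega>)"
  have pooled: "pooled_mean n N (\<lambda>s. H s \<omega>) (\<lambda>s. U s \<omega>) = xb \<omega>" for \<omega>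
    unfolding xb_def X_def m_def by (rule pooled_mean_eq_sample_mean)
  have hb_X: "sample_mean n (\<lambda>s. H s \<omega>) = sample_mean n (\<lambda>s. X s \<omega>)" for \<omega>
    by (rule sample_mean_cong) (simp add: X_def)
  \<comment> \<open>\<open>S2\<close> is a function \<open>\<phi>\<close> of the independent vectors of residuals and surrogates\<close>
  define \<phi> where "\<phi> = (\<lambda>e g. mla_noise n \<beta> (sample_mean n g - sample_mean m g) e g)"
  define S1 S2 where "S1 = (\<lambda>\<omega>. \<beta> * (xb \<omega> - \<mu>'))" and "S2 = (\<lambda>\<omega>. \<phi> (Ev \<omega>) (Xv \<omega>))"
  have n_sub: "{1..n} \<subseteq> {1..m}" by (auto simp: m_def)
  have Xv_mean: "sample_mean n (Xv \<omega>) = sample_mean n (\<lambda>s. H s \<omega>)" "sample_mean m (Xv \<omega>) = xb \<omega>" for \<omega>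
    unfolding hb_X xb_def using n_sub by (auto intro!: sample_mean_cong simp: Xv_def)
  have S2_eq: "S2 \<omega> = mla_noise n \<beta> (sample_mean n (\<lambda>s. H s \<omega>) - xb \<omega>) (\<lambda>s. E s \<omega>) (\<lambda>s. H s \<omega>)" for \<omega>
    unfolding S2_def \<phi>_def Xv_mean using n_sub
    by (intro mla_noise_cong) (auto simp: Ev_def Xv_def X_def)

  have decomposition: "mla_mean n N (\<lambda>s. R s \<omega>) (\<lambda>s. H s \<omega>) (\<lambda>s. U s \<omega>) = \<mu> + S1 \<omega> + S2 \<omega>" for \<omega>
    unfolding S2_eq S1_def pooled[symmetric]
    using \<open>n \<ge> 2\<close> \<open>N \<ge> 1\<close> by (intro mla_mean_decomposition) (simp_all add: E_def f_def)

  \<comment> \<open>for \<open>\<rho> = 0\<close> the law of \<open>S1\<close> is the point mass at 0, which has no density\<close>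
  have S1_law: "distr M borel S1 = normal_law 0 (1 / real (n + N) * \<rho>\<^sup>2 * \<sigma>\<^sup>2)"
  proof (cases "\<rho> = 0")
    case True
    then have "S1 = (\<lambda>_. 0)" by (simp add: S1_def \<beta>_def)
    then show ?thesis using True by (simp add: normal_law_def distr_const)
  next
    case False
    then have "\<beta> \<noteq> 0" using \<open>\<sigma> > 0\<close> \<open>\<sigma>' > 0\<close> by (simp add: \<beta>_def)
    have "distributed M lborel xb (normal_density \<mu>' (\<sigma>' / sqrt (real m)))"
      unfolding xb_def using \<open>m \<ge> 1\<close> X_indep \<open>\<sigma>' > 0\<close> X_normal by (rule sample_mean_normal)
    from normal_density_affine[OF this _ \<open>\<beta> \<noteq> 0\<close>, of "- \<beta> * \<mu>'"]
    have "distributed M lborel S1 (normal_density 0 (\<bar>\<beta>\<bar> * (\<sigma>' / sqrt (real m))))"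
      using \<open>\<sigma>' > 0\<close> \<open>m \<ge> 1\<close> by (simp add: S1_def algebra_simps)
    from distr_eq_normal_law[OF this]
    have "distr M borel S1 = normal_law 0 ((\<bar>\<beta>\<bar> * (\<sigma>' / sqrt (real m)))\<^sup>2)"
      using \<open>\<sigma>' > 0\<close> \<open>m \<ge> 1\<close> \<open>\<beta> \<noteq> 0\<close> by simp
    also have "(\<bar>\<beta>\<bar> * (\<sigma>' / sqrt (real m)))\<^sup>2 = 1 / real (n + N) * \<rho>\<^sup>2 * \<sigma>\<^sup>2"
      using \<open>\<sigma>' > 0\<close> by (simp add: \<beta>_def m_def power_mult_distrib power_divide)
    finally show ?thesis .
  qed

  have S1_S2: "indep_var borel S1 borel S2"
  proof -
    have mean_residuals: "indep_rv borel xb ?PX Rv"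
      unfolding xb_def Rv_def
      using \<open>m \<ge> 1\<close> X_indep \<open>\<sigma>' > 0\<close> X_normal by (rule sample_mean_indep_deviations)
    have res_meas: "(\<lambda>g. (sample_mean m g, \<lambda>i\<in>{1..m}. g i - sample_mean m g)) \<in> measurable ?PX (borel \<Otimes>\<^sub>M ?PX)"
      by (intro measurable_Pair measurable_restrict borel_measurable_diff measurable_component_singleton
          measurable_sample_mean_PiM) auto
    have "(\<lambda>i\<in>{1..m}. Xv \<omega> i - sample_mean m (Xv \<omega>)) = Rv \<omega>" for \<omega>
      unfolding Xv_mean Rv_def by (rule restrict_ext) (simp add: Xv_def)
    then have "indep_rv (borel \<Otimes>\<^sub>M ?PX) (\<lambda>\<omega>. (xb \<omega>, Rv \<omega>)) ?PE Ev"
      using indep_rv_compose[OF indep_rv_sym[OF Ev_Xv] res_meas measurable_ident]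
      by (simp add: Xv_mean)
    \<comment> \<open>the pooled mean is independent of the deviations \<open>Rv\<close> and the residuals \<open>Ev\<close> jointly\<close>
    from indep_rv_assoc[OF mean_residuals this]
    have mean_rest: "indep_rv borel xb (?PX \<Otimes>\<^sub>M ?PE) (\<lambda>\<omega>. (Rv \<omega>, Ev \<omega>))" .
    have noise_meas: "(\<lambda>p. mla_noise n \<beta> (sample_mean n (fst p)) (snd p) (fst p))
        \<in> borel_measurable (?PX \<Otimes>\<^sub>M ?PE)"
      using n_sub
      by (intro measurable_mla_noise measurable_compose[OF measurable_fst]
          measurable_compose[OF measurable_snd] measurable_component_singleton
          measurable_sample_mean_PiM) auto
    have "S2 \<omega> = mla_noise n \<beta> (sample_mean n (Rv \<omega>)) (Ev \<omega>) (Rv \<omega>)" for \<omega>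
    proof -
      have "sample_mean n (Rv \<omega>) = sample_mean n (\<lambda>s. X s \<omega> - xb \<omega>)"
        using n_sub by (intro sample_mean_cong) (auto simp: Rv_def)
      also have "\<dots> = sample_mean n (\<lambda>s. X s \<omega>) - xb \<omega>"
        using \<open>n \<ge> 1\<close> by (simp add: sample_mean_def sum_subtractf diff_divide_distrib)
      finally have d: "sample_mean n (Rv \<omega>) = sample_mean n (\<lambda>s. H s \<omega>) - xb \<omega>"
        unfolding hb_X .
      have "mla_noise n \<beta> (sample_mean n (Rv \<omega>)) (Ev \<omega>) (Rv \<omega>)
          = mla_noise n \<beta> (sample_mean n (Rv \<omega>)) (\<lambda>s. E s \<omega>) (\<lambda>s. H s \<omega> - xb \<omega>)"
        using n_sub by (intro mla_noise_cong) (auto simp: Ev_def Rv_def X_def)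
      then show ?thesis unfolding S2_eq mla_noise_shift[OF \<open>n \<ge> 1\<close>] d by simp
    qed
    then have S2_Rv: "S2 = (\<lambda>\<omega>. mla_noise n \<beta> (sample_mean n (Rv \<omega>)) (Ev \<omega>) (Rv \<omega>))" by (rule ext)
    have "(\<lambda>x. \<beta> * (x - \<mu>')) \<in> borel_measurable borel" by measurable
    from indep_rv_compose[OF mean_rest this noise_meas]
    show ?thesis unfolding indep_var_iff_indep_rv S1_def S2_Rv by simp
  qed

  let ?gen = "{U s -` A \<inter> space M | s A. s \<in> {1..N} \<and> A \<in> sets borel} \<union>
        {H s -` A \<inter> space M | s A. s \<in> {1..n} \<and> A \<in> sets borel}"
  have gen: "?gen \<subseteq> Pow (space M)" by auto
  have space_F: "space F = space M" and sets_F: "sets F = sigma_sets (space M) ?gen"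
    unfolding F_def surrogate_field_def using gen by (simp_all add: space_measure_of sets_measure_of)
  have U_F: "U s \<in> borel_measurable F" if "s \<in> {1..N}" for s
  proof (rule measurableI)
    fix A :: "real set" assume "A \<in> sets borel"
    then have "U s -` A \<inter> space M \<in> ?gen" using that by blast
    then show "U s -` A \<inter> space F \<in> sets F" unfolding space_F sets_F by (rule sigma_sets.Basic)
  qed simp
  have H_F: "H s \<in> borel_measurable F" if "s \<in> {1..n}" for s
  proof (rule measurableI)
    fix A :: "real set" assume "A \<in> sets borel"
    then have "H s -` A \<inter> space M \<in> ?gen" using that by blast
    then show "H s -` A \<inter> space F \<in> sets F" unfolding space_F sets_F by (rule sigma_sets.Basic)
  qed simp
  have Xv_rv: "random_variable ?PX Xv" using indep_rvD(2)[OF Ev_Xv] .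
  have F_Xv: "sets F \<subseteq> sets (vimage_algebra (space M) Xv ?PX)"
  proof -
    let ?W = "vimage_algebra (space M) Xv ?PX"
    have "X i \<in> borel_measurable ?W" if "i \<in> {1..m}" for i
    proof -
      have "Xv \<in> measurable ?W ?PX"
        using measurable_space[OF Xv_rv] by (intro measurable_vimage_algebra1) auto
      from measurable_compose[OF this measurable_component_singleton[OF that]]
      show ?thesis using that by (simp add: Xv_def)
    qed
    then have X_W: "X i -` A \<inter> space M \<in> sets ?W" if "i \<in> {1..m}" "A \<in> sets borel" for i A
      using measurable_sets[of "X i" ?W borel A] that by simp
    have "U s -` A \<inter> space M \<in> sets ?W" if "s \<in> {1..N}" "A \<in> sets borel" for s A
      using X_W[of "s + n" A] that by (auto simp: X_def m_def)
    moreover have "H s -` A \<inter> space M \<in> sets ?W" if "s \<in> {1..n}" "A \<in> sets borel" for s A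
      using X_W[of s A] that by (auto simp: X_def m_def)
    ultimately have "?gen \<subseteq> sets ?W" by blast
    then have "sigma_sets (space ?W) ?gen \<subseteq> sets ?W" by (rule sets.sigma_sets_subset)
    then show ?thesis by (simp add: sets_F)
  qed
  have sub: "subalgebra M F"
  proof -
    have "sets (vimage_algebra (space M) Xv ?PX) \<subseteq> sets M"
      using Xv_rv by (rule measurable_iff_sets[THEN iffD1, THEN conjunct2])
    then show ?thesis using F_Xv space_F by (auto simp: subalgebra_def)
  qed
  have Z_F: "Z \<in> borel_measurable F"
    unfolding Z_def by (intro measurable_mla_Z H_F U_F)
  have "(\<lambda>\<omega>. pooled_mean n N (\<lambda>s. H s \<omega>) (\<lambda>s. U s \<omega>)) \<in> borel_measurable F"
    by (intro measurable_pooled_mean H_F U_F)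
  then have S1_F: "S1 \<in> borel_measurable F" unfolding pooled S1_def by simp

  let ?K = "\<lambda>\<omega>. normal_law 0 (1 / real n * Z \<omega> * (1 - \<rho>\<^sup>2) * \<sigma>\<^sup>2)"
  have K: "?K \<in> measurable F (prob_algebra borel)"
  proof (rule measurable_normal_law)
    show "(\<lambda>\<omega>. 1 / real n * Z \<omega> * (1 - \<rho>\<^sup>2) * \<sigma>\<^sup>2) \<in> borel_measurable F" using Z_F by measurable
    have "Z \<omega> \<ge> 1" for \<omega> unfolding Z_def by (rule mla_Z_ge_1)
    then have "Z \<omega> > 0" for \<omega> by (rule less_le_trans[OF zero_less_one])
    then show "1 / real n * Z \<omega> * (1 - \<rho>\<^sup>2) * \<sigma>\<^sup>2 > 0" for \<omega>
      using \<open>n \<ge> 1\<close> \<rho> \<open>\<sigma> > 0\<close> by simp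
  qed
  \<comment> \<open>if all online surrogates agree then \<open>H 1 = H 2\<close>, but \<open>H 1 - H 2\<close> has a density\<close>
  have nondegenerate: "AE \<omega> in M. (\<Sum>s=1..n. (H s \<omega> - sample_mean n (\<lambda>s. H s \<omega>))\<^sup>2) \<noteq> 0"
  proof -
    define w where "w = (\<lambda>i :: nat. if i = 1 then 1 else - 1 :: real)"
    have "distributed M lborel (\<lambda>\<omega>. \<Sum>i\<in>{1, 2}. w i * X i \<omega>)
      (normal_density (\<Sum>i\<in>{1, 2}. w i * \<mu>') (sqrt (\<Sum>i\<in>{1, 2}. (w i * \<sigma>')\<^sup>2)))"
      using \<open>n \<ge> 2\<close> \<open>\<sigma>' > 0\<close> X_normal
      by (intro normal_linear_combination[where j=1] indep_vars_subset[OF X_indep])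
         (auto simp: m_def w_def)
    from distributed_lborel_AE_neq[OF this, of 0]
    have "AE \<omega> in M. X 1 \<omega> \<noteq> X 2 \<omega>" by (simp add: w_def)
    then show ?thesis
    proof (rule AE_mp, intro AE_I2 impI notI)
      fix \<omega> assume "X 1 \<omega> \<noteq> X 2 \<omega>"
        and "(\<Sum>s=1..n. (H s \<omega> - sample_mean n (\<lambda>s. H s \<omega>))\<^sup>2) = 0"
      then have "H s \<omega> = sample_mean n (\<lambda>s. H s \<omega>)" if "s \<in> {1..n}" for s
        using that by (simp add: sum_nonneg_eq_0_iff)
      from this[of 1] this[of 2] \<open>X 1 \<omega> \<noteq> X 2 \<omega>\<close> \<open>n \<ge> 2\<close> show False by (simp add: X_def)
    qed
  qed
  have cond: "has_cond_distr M F borel S2 ?K"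
    unfolding S2_def
  proof (rule has_cond_distr_freezing[OF Ev_Xv _ sub F_Xv K])
    show "(\<lambda>p. \<phi> (fst p) (snd p)) \<in> borel_measurable (?PE \<Otimes>\<^sub>M ?PX)"
      unfolding \<phi>_def using n_sub
      by (intro measurable_mla_noise borel_measurable_diff measurable_compose[OF measurable_fst]
          measurable_compose[OF measurable_snd] measurable_component_singleton
          measurable_sample_mean_PiM) auto
    show "AE \<omega> in M. distr M borel (\<lambda>\<omega>'. \<phi> (Ev \<omega>') (Xv \<omega>)) = ?K \<omega>"
      using nondegenerate
    proof (rule AE_mp, intro AE_I2 impI)
      fix \<omega> assume S: "(\<Sum>s=1..n. (H s \<omega> - sample_mean n (\<lambda>s. H s \<omega>))\<^sup>2) \<noteq> 0"
      have "\<phi> (Ev \<omega>') (Xv \<omega>) = mla_noise n \<beta> (sample_mean n (\<lambda>s. H s \<omega>) - xb \<omega>) (\<lambda>s. E s \<omega>') (\<lambda>s. H s \<omega>)" for \<omega>'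
        unfolding \<phi>_def Xv_mean using n_sub
        by (intro mla_noise_cong) (auto simp: Ev_def Xv_def X_def)
      then show "distr M borel (\<lambda>\<omega>'. \<phi> (Ev \<omega>') (Xv \<omega>)) = ?K \<omega>"
        using distr_mla_noise[OF \<open>n \<ge> 1\<close> E_indep \<open>\<tau> > 0\<close> regression(2) refl S]
        by (simp add: Z_def mla_Z_def pooled \<tau>2 mult.assoc)
    qed
  qed
  show ?thesis
    using Z_F decomposition S1_S2 S1_F S1_law cond by blast
qed

end
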